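(* Let $\mathcal{J}$ be an operator ideal such that $\mathcal{J}^2\ne\mathcal{J}$. Then $\mathrm{Span}_\mathbb{R}(\mathcal{D}_\mathcal{J}^{sa})\ne\mathcal{J}^{sa}$, where $\mathcal{J}^{sa}$ is the set of self-adjoint elements of $\mathcal{J}$ and $$\mathcal{D}_\mathcal{J}^{sa}=\{VDV^*: D=D^*\in\mathcal{D}\cap\mathcal{J},\ V\in\mathcal{U}_\mathcal{J}(\mathcal{H})\}.$$
   Context: $\mathcal{H}$ is a separable infinite-dimensional complex Hilbert space with a fixed orthonormal basis; $\mathcal{D}$ is the algebra of operators diagonal with respect to this basis. An operator ideal is a two-sided ideal of $\mathcal{B}(\mathcal{H})$; $\mathcal{J}^2=\mathrm{Span}\{XY:X,Y\in\mathcal{J}\}$. $\mathcal{U}_\mathcal{J}(\mathcal{H})=\{U\text{ unitary}: U-I\in\mathcal{J}\}$. *)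

theory Defs
  imports Complex_Main
begin

text \<open>H = l2(nat) with its standard orthonormal basis; a bounded operator is
  represented by its matrix with respect to this basis.\<close>

type_synonym mat = "nat \<Rightarrow> nat \<Rightarrow> complex"

definition bounded_mat :: "mat \<Rightarrow> bool" where
  "bounded_mat A \<longleftrightarrow> (\<exists>C. \<forall>(x::nat \<Rightarrow> complex) n m.
      (\<Sum>i<m. (cmod (\<Sum>j<n. A i j * x j))\<^sup>2) \<le> C * (\<Sum>j<n. (cmod (x j))\<^sup>2))"

definition mat_mult :: "mat \<Rightarrow> mat \<Rightarrow> mat" where
  "mat_mult A B = (\<lambda>i j. \<Sum>k. A i k * B k j)"

definition adj :: "mat \<Rightarrow> mat" where
  "adj A = (\<lambda>i j. cnj (A j i))"

definition mat_id :: mat where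
  "mat_id = (\<lambda>i j. if i = j then 1 else 0)"

definition diagonal :: "mat \<Rightarrow> bool" where
  "diagonal A \<longleftrightarrow> bounded_mat A \<and> (\<forall>i j. i \<noteq> j \<longrightarrow> A i j = 0)"

definition operator_ideal :: "mat set \<Rightarrow> bool" where
  "operator_ideal J \<longleftrightarrow> J \<subseteq> Collect bounded_mat \<and> (\<lambda>i j. 0) \<in> J
    \<and> (\<forall>X\<in>J. \<forall>Y\<in>J. (\<lambda>i j. X i j + Y i j) \<in> J)
    \<and> (\<forall>c X. X \<in> J \<longrightarrow> (\<lambda>i j. c * X i j) \<in> J)
    \<and> (\<forall>X\<in>J. \<forall>A. bounded_mat A \<longrightarrow> mat_mult A X \<in> J \<and> mat_mult X A \<in> J)"

definition ideal_sq :: "mat set \<Rightarrow> mat set" where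
  "ideal_sq J = {S. \<exists>n (c::nat \<Rightarrow> complex) X Y. (\<forall>k<n. X k \<in> J \<and> Y k \<in> J) \<and>
      S = (\<lambda>i j. \<Sum>k<n. c k * mat_mult (X k) (Y k) i j)}"

definition real_span_mat :: "mat set \<Rightarrow> mat set" where
  "real_span_mat S = {T. \<exists>n (r::nat \<Rightarrow> real) A. (\<forall>k<n. A k \<in> S) \<and>
      T = (\<lambda>i j. \<Sum>k<n. complex_of_real (r k) * A k i j)}"

definition unitary :: "mat \<Rightarrow> bool" where
  "unitary U \<longleftrightarrow> bounded_mat U \<and> mat_mult U (adj U) = mat_id \<and> mat_mult (adj U) U = mat_id"

definition unitary_J :: "mat set \<Rightarrow> mat set" where
  "unitary_J J = {U. unitary U \<and> (\<lambda>i j. U i j - mat_id i j) \<in> J}"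

definition self_adjoint_part :: "mat set \<Rightarrow> mat set" where
  "self_adjoint_part J = {X \<in> J. adj X = X}"

definition diag_orbit_sa :: "mat set \<Rightarrow> mat set" where
  "diag_orbit_sa J = {mat_mult (mat_mult V D) (adj V) | V D.
      diagonal D \<and> D \<in> J \<and> adj D = D \<and> V \<in> unitary_J J}"

end

theory Submission
  imports Defs "HOL-Complex_Analysis.Great_Picard"
begin

text \<open>If \<open>V = 1 + K\<close> is unitary with \<open>K \<in> J\<close>, then \<open>V D V\<^sup>* - D = (K D - D K) V\<^sup>*\<close> lies in \<open>J\<^sup>2\<close>, so an
  element of the span of the diagonal orbits has all its off-diagonal corners in \<open>J\<^sup>2\<close>. If the span were
  all of the self-adjoint part of \<open>J\<close>, placing a self-adjoint \<open>h \<in> J\<close> in such a corner would give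
  \<open>h \<in> J\<^sup>2\<close>. Every \<open>y \<in> J\<close> generates the same left ideal as its modulus \<open>h = (y\<^sup>* y)\<^sup>1\<^sup>/\<^sup>2\<close>, whence
  \<open>J = J\<^sup>2\<close>. The modulus is obtained from the binomial series in the C*-algebra of bounded matrices, and
  the factors relating it to \<open>y\<close> from weak limits.\<close>

section \<open>Square-summable sequences and bounded matrices\<close>

text \<open>An operator of the orbit does not itself lie in J^2: its summand D is only known to be
  in J. Hence the corner: two isometries with orthogonal ranges spanned by basis vectors kill D on
  compression, and each range is still a full copy of H, with room for an arbitrary h. The span
  gives access to self-adjoint elements only. Splitting y into real and imaginary parts would
  presuppose that J is closed under adjoints, which \<open>operator_ideal\<close> does not state and
  which is usually deduced from polar decomposition. With the modulus, h = v y is in J by left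
  multiplication alone, and y = u h carries membership in J^2 back to y. The factors u and v cannot
  be expected as norm limits, since the partial isometry of a polar decomposition is in general
  outside the C*-algebra generated by y. But a norm-bounded sequence converges entrywise along a
  subsequence, and multiplication by a fixed operator on the right respects such limits.\<close>

definition l2norm :: "(nat \<Rightarrow> complex) \<Rightarrow> nat \<Rightarrow> real" where
  "l2norm x n = L2_set (\<lambda>i. cmod (x i)) {..<n}"

text \<open>Membership in the closed ball of radius \<open>c\<close> of l2, phrased without an
  infinite sum.\<close>

definition l2_bound :: "(nat \<Rightarrow> complex) \<Rightarrow> real \<Rightarrow> bool" where
  "l2_bound x c \<longleftrightarrow> (\<forall>n. l2norm x n \<le> c)"

text \<open>The vector \<open>y\<close> enters without conjugation, so the condition is symmetric in
  rows and columns: transpose and adjoint inherit the same constant. Finite truncations keep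
  questions of convergence out of the definition.\<close>

definition form_bound :: "mat \<Rightarrow> real \<Rightarrow> bool" where
  "form_bound A c \<longleftrightarrow> 0 \<le> c \<and>
     (\<forall>x y m n. cmod (\<Sum>i<m. \<Sum>j<n. y i * A i j * x j) \<le> c * (l2norm y m * l2norm x n))"

lemma l2norm_nonneg [simp]: "0 \<le> l2norm x n"
  by (simp add: l2norm_def)

lemma l2norm_power2: "(l2norm x n)\<^sup>2 = (\<Sum>i<n. (cmod (x i))\<^sup>2)"
  by (simp add: l2norm_def L2_set_def sum_nonneg)

lemma l2norm_cnj [simp]: "l2norm (\<lambda>i. cnj (x i)) n = l2norm x n"
  by (simp add: l2norm_def)

lemma l2norm_mono: "m \<le> n \<Longrightarrow> l2norm x m \<le> l2norm x n"
  unfolding l2norm_def L2_set_def by (intro real_sqrt_le_mono sum_mono2) auto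

lemma l2_bound_nonneg: "l2_bound x c \<Longrightarrow> 0 \<le> c"
  unfolding l2_bound_def using l2norm_nonneg order_trans by blast

lemma l2_dot_abs: "(\<Sum>i<n. cmod (a i * b i)) \<le> l2norm a n * l2norm b n"
  using L2_set_mult_ineq[of "\<lambda>i. cmod (a i)" "\<lambda>i. cmod (b i)" "{..<n}"]
  by (simp add: l2norm_def norm_mult)

lemma l2_dot: "cmod (\<Sum>i<n. a i * b i) \<le> l2norm a n * l2norm b n"
  by (rule order_trans[OF norm_sum l2_dot_abs])

section \<open>Bounds for bilinear forms of matrices\<close>

lemma form_boundD:
  "form_bound A c \<Longrightarrow> cmod (\<Sum>i<m. \<Sum>j<n. y i * A i j * x j) \<le> c * (l2norm y m * l2norm x n)"
  by (simp add: form_bound_def)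

lemma form_bound_nonneg: "form_bound A c \<Longrightarrow> 0 \<le> c"
  by (simp add: form_bound_def)

lemma form_bound_transpose:
  assumes "form_bound A c" shows "form_bound (\<lambda>i j. A j i) c"
  unfolding form_bound_def
proof (intro conjI allI)
  fix x y m n
  have "(\<Sum>i<m. \<Sum>j<n. y i * A j i * x j) = (\<Sum>j<n. \<Sum>i<m. x j * A j i * y i)"
    by (subst sum.swap) (simp add: mult_ac)
  then show "cmod (\<Sum>i<m. \<Sum>j<n. y i * A j i * x j) \<le> c * (l2norm y m * l2norm x n)"
    using form_boundD[OF assms, where m=n and n=m and x=y and y=x] by (simp add: mult_ac)
qed (use assms form_bound_nonneg in auto)

lemma form_bound_adj:
  assumes "form_bound A c" shows "form_bound (adj A) c"
  unfolding form_bound_def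
proof (intro conjI allI)
  fix x y m n
  have "(\<Sum>i<m. \<Sum>j<n. y i * adj A i j * x j)
      = cnj (\<Sum>i<m. \<Sum>j<n. cnj (y i) * A j i * cnj (x j))"
    by (simp add: adj_def)
  also have "cmod \<dots> \<le> c * (l2norm y m * l2norm x n)"
    unfolding complex_mod_cnj
    using form_boundD[OF form_bound_transpose[OF assms], where y="\<lambda>i. cnj (y i)" and x="\<lambda>i. cnj (x i)"]
    by simp
  finally show "cmod (\<Sum>i<m. \<Sum>j<n. y i * adj A i j * x j) \<le> c * (l2norm y m * l2norm x n)" .
qed (use assms form_bound_nonneg in auto)

text \<open>Testing the form against the conjugate of v = A x gives |v|^2 \<le> c |v| |x|; cancel
  |v| unless it vanishes.\<close>

lemma l2norm_matvec:
  assumes "form_bound A c"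
  shows "l2norm (\<lambda>i. \<Sum>j<n. A i j * x j) m \<le> c * l2norm x n"
proof -
  define v where "v i = (\<Sum>j<n. A i j * x j)" for i
  have "(l2norm v m)\<^sup>2 = cmod (\<Sum>i<m. of_real ((cmod (v i))\<^sup>2))"
    unfolding l2norm_power2 of_real_sum[symmetric] norm_of_real by (simp add: sum_nonneg)
  also have "(\<Sum>i<m. of_real ((cmod (v i))\<^sup>2)) = (\<Sum>i<m. cnj (v i) * v i)"
    by (intro sum.cong refl) (metis complex_norm_square mult.commute)
  also have "\<dots> = (\<Sum>i<m. \<Sum>j<n. cnj (v i) * A i j * x j)"
    by (simp add: v_def[of "_"] sum_distrib_left mult.assoc del: cnj_sum)
  also have "cmod \<dots> \<le> c * (l2norm v m * l2norm x n)"
    using form_boundD[OF assms, where y="\<lambda>i. cnj (v i)"] by simp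
  finally have "l2norm v m * l2norm v m \<le> l2norm v m * (c * l2norm x n)"
    by (simp add: power2_eq_square mult_ac)
  then have "l2norm v m \<le> c * l2norm x n"
    using form_bound_nonneg[OF assms] l2norm_nonneg[of v m]
    by (cases "l2norm v m = 0") (auto simp: mult_le_cancel_left)
  then show ?thesis by (simp add: v_def[abs_def])
qed

lemma form_boundI:
  assumes "0 \<le> c" and le: "\<And>x m n. l2norm (\<lambda>i. \<Sum>j<n. A i j * x j) m \<le> c * l2norm x n"
  shows "form_bound A c"
  unfolding form_bound_def
proof (intro conjI allI)
  fix x y m n
  have "(\<Sum>i<m. \<Sum>j<n. y i * A i j * x j) = (\<Sum>i<m. y i * (\<Sum>j<n. A i j * x j))"
    by (simp add: sum_distrib_left mult.assoc)
  also have "cmod \<dots> \<le> l2norm y m * l2norm (\<lambda>i. \<Sum>j<n. A i j * x j) m"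
    by (rule l2_dot)
  also have "\<dots> \<le> l2norm y m * (c * l2norm x n)"
    by (intro mult_left_mono le) auto
  finally show "cmod (\<Sum>i<m. \<Sum>j<n. y i * A i j * x j) \<le> c * (l2norm y m * l2norm x n)"
    by (simp add: mult_ac)
qed fact

lemma bounded_mat_iff: "bounded_mat A \<longleftrightarrow> (\<exists>c. form_bound A c)"
proof
  assume "bounded_mat A"
  then obtain C where C: "\<And>x n m. (\<Sum>i<m. (cmod (\<Sum>j<n. A i j * x j))\<^sup>2) \<le> C * (\<Sum>j<n. (cmod (x j))\<^sup>2)"
    unfolding bounded_mat_def by blast
  \<comment> \<open>\<open>bounded_mat\<close> fixes no sign for \<open>C\<close>;
    \<open>max C 0\<close> makes the square root nonnegative.\<close>
  have "form_bound A (sqrt (max C 0))"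
  proof (rule form_boundI)
    fix x m n
    have "(l2norm (\<lambda>i. \<Sum>j<n. A i j * x j) m)\<^sup>2 \<le> C * (l2norm x n)\<^sup>2"
      using C by (simp add: l2norm_power2)
    also have "\<dots> \<le> max C 0 * (l2norm x n)\<^sup>2"
      by (intro mult_right_mono) auto
    also have "\<dots> = (sqrt (max C 0) * l2norm x n)\<^sup>2"
      by (simp add: power_mult_distrib)
    finally show "l2norm (\<lambda>i. \<Sum>j<n. A i j * x j) m \<le> sqrt (max C 0) * l2norm x n"
      by (rule power2_le_imp_le) auto
  qed auto
  then show "\<exists>c. form_bound A c" ..
next
  assume "\<exists>c. form_bound A c"
  then obtain c where c: "form_bound A c" ..
  show "bounded_mat A"
    unfolding bounded_mat_def
  proof (intro exI allI)
    fix x n m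
    have "(l2norm (\<lambda>i. \<Sum>j<n. A i j * x j) m)\<^sup>2 \<le> (c * l2norm x n)\<^sup>2"
      by (intro power_mono l2norm_matvec c) auto
    then show "(\<Sum>i<m. (cmod (\<Sum>j<n. A i j * x j))\<^sup>2) \<le> c\<^sup>2 * (\<Sum>j<n. (cmod (x j))\<^sup>2)"
      by (simp add: l2norm_power2 power_mult_distrib)
  qed
qed

lemma form_bound_cmult:
  assumes "form_bound A c" shows "form_bound (\<lambda>i j. z * A i j) (cmod z * c)"
  unfolding form_bound_def
proof (intro conjI allI)
  fix x y m n
  have "(\<Sum>i<m. \<Sum>j<n. y i * (z * A i j) * x j) = z * (\<Sum>i<m. \<Sum>j<n. y i * A i j * x j)"
    by (simp add: sum_distrib_left mult_ac)
  then show "cmod (\<Sum>i<m. \<Sum>j<n. y i * (z * A i j) * x j) \<le> cmod z * c * (l2norm y m * l2norm x n)"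
    using form_boundD[OF assms, where y=y and m=m and n=n and x=x]
    by (simp add: norm_mult mult.assoc mult_left_mono)
qed (use assms form_bound_nonneg in auto)

lemma form_bound_add:
  assumes "form_bound A c" "form_bound B d" shows "form_bound (\<lambda>i j. A i j + B i j) (c + d)"
  unfolding form_bound_def
proof (intro conjI allI)
  fix x y m n
  have "(\<Sum>i<m. \<Sum>j<n. y i * (A i j + B i j) * x j)
      = (\<Sum>i<m. \<Sum>j<n. y i * A i j * x j) + (\<Sum>i<m. \<Sum>j<n. y i * B i j * x j)"
    by (simp add: algebra_simps sum.distrib)
  then show "cmod (\<Sum>i<m. \<Sum>j<n. y i * (A i j + B i j) * x j) \<le> (c + d) * (l2norm y m * l2norm x n)"
    using form_boundD[OF assms(1), where y=y and m=m and n=n and x=x]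
      form_boundD[OF assms(2), where y=y and m=m and n=n and x=x]
    by (simp add: distrib_right norm_triangle_le)
qed (use assms form_bound_nonneg in auto)

text \<open>Each of the defining inequalities involves finitely many entries, so it survives an
  entrywise limit.\<close>

lemma form_bound_lim:
  assumes "\<And>N. form_bound (A N) c" and "\<And>i j. (\<lambda>N::nat. A N i j) \<longlonglongrightarrow> B i j"
  shows "form_bound B c"
  unfolding form_bound_def
proof (intro conjI allI)
  fix x y m n
  have "(\<lambda>N. cmod (\<Sum>i<m. \<Sum>j<n. y i * A N i j * x j)) \<longlonglongrightarrow> cmod (\<Sum>i<m. \<Sum>j<n. y i * B i j * x j)"
    by (intro tendsto_intros assms)
  then show "cmod (\<Sum>i<m. \<Sum>j<n. y i * B i j * x j) \<le> c * (l2norm y m * l2norm x n)"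
    by (rule LIMSEQ_le_const2) (use form_boundD[OF assms(1)] in blast)
qed (rule form_bound_nonneg[OF assms(1)])

lemma form_bound_entry:
  assumes "form_bound A c" shows "cmod (A i j) \<le> c"
proof -
  let ?e = "\<lambda>k l. if l = k then 1 else (0::complex)"
  have sum_delta_lessThan: "(\<Sum>l<Suc k. f l * ?e k l) = f k" for k and f :: "nat \<Rightarrow> complex"
    by (simp add: if_distrib[of "times _"] sum.delta' cong: if_cong)
  have norm_e: "l2norm (?e k) (Suc k) = 1" for k
    by (simp add: l2norm_def L2_set_def if_distrib[of cmod] if_distrib[of "\<lambda>t. t^2"] cong: if_cong)
  have "(\<Sum>p<Suc i. \<Sum>q<Suc j. ?e i p * A p q * ?e j q) = (\<Sum>p<Suc i. A p j * ?e i p)"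
    by (simp only: sum_delta_lessThan) (simp add: mult.commute)
  also have "\<dots> = A i j" by (rule sum_delta_lessThan)
  finally show ?thesis
    using form_boundD[OF assms, where m="Suc i" and n="Suc j" and y="?e i" and x="?e j"]
    by (simp only: norm_e mult_1_right)
qed

section \<open>Rows and columns as square-summable sequences, and limits of their pairings\<close>

lemma l2_bound_col:
  assumes "form_bound A c" shows "l2_bound (\<lambda>i. A i j) c"
  unfolding l2_bound_def
proof
  fix n
  let ?e = "\<lambda>l. if l = j then 1 else (0::complex)"
  have "l2norm (\<lambda>i. \<Sum>l<Suc j. A i l * ?e l) n \<le> c * l2norm ?e (Suc j)"
    by (rule l2norm_matvec[OF assms])
  moreover have "(\<Sum>l<Suc j. A i l * ?e l) = A i j" for i
    by (simp add: if_distrib[of "times _"] sum.delta' cong: if_cong)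
  moreover have "l2norm ?e (Suc j) = 1"
    by (simp add: l2norm_def L2_set_def if_distrib[of cmod] if_distrib[of "\<lambda>t. t^2"] cong: if_cong)
  ultimately show "l2norm (\<lambda>i. A i j) n \<le> c" by simp
qed

lemma l2_bound_row: "form_bound A c \<Longrightarrow> l2_bound (\<lambda>j. A i j) c"
  using l2_bound_col[OF form_bound_transpose] by fast

lemma l2_bound_comb_rows:
  assumes "form_bound A c" shows "l2_bound (\<lambda>k. \<Sum>i<m. y i * A i k) (c * l2norm y m)"
  using l2norm_matvec[OF form_bound_transpose[OF assms], where n=m and x=y]
  by (simp add: l2_bound_def mult.commute)

lemma l2_bound_comb_cols:
  assumes "form_bound A c" shows "l2_bound (\<lambda>k. \<Sum>j<n. A k j * x j) (c * l2norm x n)"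
  using l2norm_matvec[OF assms] by (simp add: l2_bound_def)

lemma l2_summable:
  assumes "l2_bound a c" "l2_bound b d" shows "summable (\<lambda>k. cmod (a k * b k))"
proof (rule summableI_nonneg_bounded[where x="c * d"])
  fix n
  have "(\<Sum>i<n. cmod (a i * b i)) \<le> l2norm a n * l2norm b n" by (rule l2_dot_abs)
  also have "\<dots> \<le> c * d"
    using assms l2_bound_nonneg[OF assms(1)] by (intro mult_mono) (auto simp: l2_bound_def)
  finally show "(\<Sum>i<n. cmod (a i * b i)) \<le> c * d" .
qed auto

lemma l2_dot_suminf:
  assumes "l2_bound a c" "l2_bound b d" shows "cmod (\<Sum>k. a k * b k) \<le> c * d"
proof -
  have "(\<lambda>n. cmod (\<Sum>k<n. a k * b k)) \<longlonglongrightarrow> cmod (\<Sum>k. a k * b k)"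
    by (intro tendsto_norm summable_LIMSEQ summable_norm_cancel[OF l2_summable[OF assms]])
  moreover have "cmod (\<Sum>k<n. a k * b k) \<le> c * d" for n
  proof -
    have "cmod (\<Sum>k<n. a k * b k) \<le> l2norm a n * l2norm b n" by (rule l2_dot)
    also have "\<dots> \<le> c * d"
      using assms l2_bound_nonneg[OF assms(1)] by (intro mult_mono) (auto simp: l2_bound_def)
    finally show ?thesis .
  qed
  ultimately show ?thesis by (blast intro: LIMSEQ_le_const2)
qed

lemma l2_bound_lim:
  assumes "\<And>N. l2_bound (u N) M" and "\<And>k. (\<lambda>N::nat. u N k) \<longlonglongrightarrow> v k"
  shows "l2_bound v M"
  unfolding l2_bound_def
proof
  fix n
  have "(\<lambda>N. l2norm (u N) n) \<longlonglongrightarrow> l2norm v n"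
    unfolding l2norm_def L2_set_def by (intro tendsto_intros assms)
  then show "l2norm v n \<le> M"
    by (rule LIMSEQ_le_const2) (use assms(1) in \<open>auto simp: l2_bound_def\<close>)
qed

lemma l2_tail_bound:
  assumes "l2_bound b d"
  obtains t where "t \<longlonglongrightarrow> 0" and "\<And>N::nat. l2_bound (\<lambda>k. b (k + N)) (t N)"
proof
  let ?f = "\<lambda>k. (cmod (b k))\<^sup>2"
  have sm: "summable ?f"
    using l2_summable[OF assms assms] by (simp add: norm_mult power2_eq_square)
  define t where "t N = sqrt (\<Sum>k. ?f (k + N))" for N
  have "(\<lambda>N. \<Sum>k. ?f (k + N)) \<longlonglongrightarrow> 0"
    using suminf_exist_split2[OF sm] .
  then show "t \<longlonglongrightarrow> 0"
    unfolding t_def using tendsto_real_sqrt by fastforce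
  show "l2_bound (\<lambda>k. b (k + N)) (t N)" for N
    unfolding l2_bound_def l2norm_def L2_set_def t_def
    by (intro allI real_sqrt_le_mono sum_le_suminf summable_ignore_initial_segment[OF sm]) auto
qed

lemma l2_bound_shift: "l2_bound a c \<Longrightarrow> l2_bound (\<lambda>k. a (k + N)) c"
proof -
  assume a: "l2_bound a c"
  have "l2norm (\<lambda>k. a (k + N)) n \<le> l2norm a (n + N)" for n
  proof -
    have "(\<Sum>i<n. (cmod (a (i + N)))\<^sup>2) = (\<Sum>i\<in>(\<lambda>i. i + N) ` {..<n}. (cmod (a i))\<^sup>2)"
      by (subst sum.reindex) (auto simp: inj_on_def)
    also have "\<dots> \<le> (\<Sum>i<n+N. (cmod (a i))\<^sup>2)"
      by (intro sum_mono2) auto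
    finally show ?thesis
      unfolding l2norm_def L2_set_def by (rule real_sqrt_le_mono)
  qed
  then show ?thesis using a unfolding l2_bound_def by (meson order_trans)
qed

text \<open>Pointwise convergence suffices because of the common bound \<open>M\<close>: beyond a
  fixed index the tail of \<open>b\<close> makes the rest of the series small for all
  \<open>N\<close> at once, and the remaining head is a finite sum.\<close>

lemma l2_weak_lim:
  assumes u: "\<And>N. l2_bound (u N) M" and lim: "\<And>k. (\<lambda>N::nat. u N k) \<longlonglongrightarrow> v k"
    and b: "l2_bound b d"
  shows "(\<lambda>N. \<Sum>k. u N k * b k) \<longlonglongrightarrow> (\<Sum>k. v k * b k)"
proof -
  have v: "l2_bound v M" by (rule l2_bound_lim[OF u lim])
  obtain t where t: "t \<longlonglongrightarrow> 0" and tb: "\<And>N. l2_bound (\<lambda>k. b (k + N)) (t N)"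
    using l2_tail_bound[OF b] by blast
  have tail: "cmod ((\<Sum>k. w k * b k) - (\<Sum>k<n. w k * b k)) \<le> M * t n" if "l2_bound w M" for w n
  proof -
    have "(\<Sum>k. w k * b k) - (\<Sum>k<n. w k * b k) = (\<Sum>k. w (k + n) * b (k + n))"
      using suminf_split_initial_segment[OF summable_norm_cancel[OF l2_summable[OF that b]], of n] by simp
    then show ?thesis using l2_dot_suminf[OF l2_bound_shift[OF that] tb] by simp
  qed
  have tri: "cmod (a - b) \<le> cmod (a - p) + cmod (p - q) + cmod (b - q)" for a b p q
    using norm_triangle_ineq4[of "(a - p) + (p - q)" "b - q"] norm_triangle_ineq[of "a - p" "p - q"] by simp
  have Mt: "(\<lambda>n. M * t n) \<longlonglongrightarrow> 0" using tendsto_mult_right_zero[OF t] .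
  show ?thesis
  proof (rule metric_LIMSEQ_I)
    fix e :: real assume "0 < e"
    then obtain n where n: "M * t n < e / 3"
      using order_tendstoD(2)[OF Mt, of "e/3"] by (auto dest: eventually_happens)
    have "(\<lambda>N. \<Sum>k<n. u N k * b k) \<longlonglongrightarrow> (\<Sum>k<n. v k * b k)"
      by (intro tendsto_intros lim)
    from LIMSEQ_D[OF this, of "e / 3"] obtain N0 where N0: "\<And>N. N \<ge> N0 \<Longrightarrow> cmod ((\<Sum>k<n. u N k * b k) - (\<Sum>k<n. v k * b k)) < e / 3"
      using \<open>0 < e\<close> by auto
    have "dist (\<Sum>k. u N k * b k) (\<Sum>k. v k * b k) < e" if "N \<ge> N0" for N
    proof -
      have "cmod ((\<Sum>k. u N k * b k) - (\<Sum>k. v k * b k))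
          \<le> cmod ((\<Sum>k. u N k * b k) - (\<Sum>k<n. u N k * b k)) + cmod ((\<Sum>k<n. u N k * b k) - (\<Sum>k<n. v k * b k))
            + cmod ((\<Sum>k. v k * b k) - (\<Sum>k<n. v k * b k))"
        by (rule tri)
      then show ?thesis
        using tail[OF u, of N n] tail[OF v, of n] N0[OF that] n by (simp add: dist_norm)
    qed
    then show "\<exists>no. \<forall>N\<ge>no. dist (\<Sum>k. u N k * b k) (\<Sum>k. v k * b k) < e" by blast
  qed
qed

section \<open>Products of bounded matrices\<close>

lemma mat_mult_summable:
  assumes "form_bound A c" "form_bound B d" shows "summable (\<lambda>k. A i k * B k j)"
  by (rule summable_norm_cancel[OF l2_summable[OF l2_bound_row[OF assms(1)] l2_bound_col[OF assms(2)]]])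

lemma form_suminf:
  fixes f :: "nat \<Rightarrow> nat \<Rightarrow> nat \<Rightarrow> complex"
  assumes "\<And>i j. summable (f i j)"
  shows "(\<Sum>i<m. \<Sum>j<n. y i * (\<Sum>k. f i j k) * x j) = (\<Sum>k. \<Sum>i<m. \<Sum>j<n. y i * f i j k * x j)"
  by (rule sums_unique) (intro sums_sum sums_mult sums_mult2 summable_sums assms)

lemma form_bound_mult:
  assumes A: "form_bound A c" and B: "form_bound B d"
  shows "form_bound (mat_mult A B) (c * d)"
  unfolding form_bound_def
proof (intro conjI allI)
  fix x y m n
  have "(\<Sum>i<m. \<Sum>j<n. y i * mat_mult A B i j * x j)
      = (\<Sum>k. \<Sum>i<m. \<Sum>j<n. y i * (A i k * B k j) * x j)"
    unfolding mat_mult_def by (rule form_suminf[OF mat_mult_summable[OF A B]])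
  also have "\<dots> = (\<Sum>k. (\<Sum>i<m. y i * A i k) * (\<Sum>j<n. B k j * x j))"
    by (simp add: sum_product mult.assoc)
  also have "cmod \<dots> \<le> (c * l2norm y m) * (d * l2norm x n)"
    by (rule l2_dot_suminf[OF l2_bound_comb_rows[OF A] l2_bound_comb_cols[OF B]])
  finally show "cmod (\<Sum>i<m. \<Sum>j<n. y i * mat_mult A B i j * x j) \<le> c * d * (l2norm y m * l2norm x n)"
    by (simp add: mult_ac)
qed (use assms form_bound_nonneg in auto)

text \<open>The double series need not converge absolutely, so the sums cannot simply be exchanged.
  The sum over \<open>l\<close> is truncated instead: \<open>B\<close> applied to a truncated column
  of \<open>C\<close> stays in the ball of radius \<open>b * c\<close> and converges entrywise, and
  \<open>l2_weak_lim\<close> pairs it with a row of \<open>A\<close>.\<close>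

lemma mat_mult_assoc:
  assumes A: "form_bound A a" and B: "form_bound B b" and C: "form_bound C c"
  shows "mat_mult (mat_mult A B) C = mat_mult A (mat_mult B C)"
proof (intro ext)
  fix i j
  note sAB = mat_mult_summable[OF A B]
  have part: "(\<Sum>l<N. mat_mult A B i l * C l j) = (\<Sum>k. (\<Sum>l<N. B k l * C l j) * A i k)" for N
  proof -
    have "(\<Sum>l<N. mat_mult A B i l * C l j) = (\<Sum>l<N. \<Sum>k. A i k * B k l * C l j)"
      unfolding mat_mult_def by (simp add: suminf_mult2 sAB)
    also have "\<dots> = (\<Sum>k. \<Sum>l<N. A i k * B k l * C l j)"
      by (simp add: suminf_sum summable_mult2 sAB)
    finally show ?thesis by (simp add: sum_distrib_left mult_ac)
  qed
  have "(\<lambda>N. \<Sum>l<N. mat_mult A B i l * C l j) \<longlonglongrightarrow> mat_mult (mat_mult A B) C i j"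
    unfolding mat_mult_def[of "mat_mult A B"]
    by (intro summable_LIMSEQ mat_mult_summable[OF form_bound_mult[OF A B] C])
  moreover have "(\<lambda>N. \<Sum>k. (\<Sum>l<N. B k l * C l j) * A i k) \<longlonglongrightarrow> (\<Sum>k. mat_mult B C k j * A i k)"
  proof (rule l2_weak_lim[where M = "b * c"])
    show "l2_bound (\<lambda>k. \<Sum>l<N. B k l * C l j) (b * c)" for N
      unfolding l2_bound_def
    proof
      fix n
      have "l2norm (\<lambda>k. \<Sum>l<N. B k l * C l j) n \<le> b * l2norm (\<lambda>l. C l j) N"
        by (rule l2norm_matvec[OF B])
      also have "\<dots> \<le> b * c"
        using l2_bound_col[OF C] form_bound_nonneg[OF B] by (intro mult_left_mono) (auto simp: l2_bound_def)
      finally show "l2norm (\<lambda>k. \<Sum>l<N. B k l * C l j) n \<le> b * c" .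
    qed
    show "(\<lambda>N. \<Sum>l<N. B k l * C l j) \<longlonglongrightarrow> mat_mult B C k j" for k
      unfolding mat_mult_def by (intro summable_LIMSEQ mat_mult_summable[OF B C])
    show "l2_bound (A i) a" using l2_bound_row[OF A] by simp
  qed
  ultimately have "mat_mult (mat_mult A B) C i j = (\<Sum>k. mat_mult B C k j * A i k)"
    using LIMSEQ_unique unfolding part by blast
  also have "\<dots> = mat_mult A (mat_mult B C) i j"
    by (simp add: mat_mult_def[of A] mult.commute)
  finally show "mat_mult (mat_mult A B) C i j = mat_mult A (mat_mult B C) i j" .
qed

lemma adj_mat_mult: "adj (mat_mult A B) = mat_mult (adj B) (adj A)" if "form_bound A a" "form_bound B b"
proof (intro ext)
  fix i j
  have "(\<lambda>k. cnj (A j k * B k i)) sums cnj (\<Sum>k. A j k * B k i)"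
    by (intro sums_cnj[THEN iffD2] summable_sums mat_mult_summable[OF that])
  then have "(\<Sum>k. cnj (A j k * B k i)) = cnj (\<Sum>k. A j k * B k i)"
    by (simp add: sums_iff)
  then show "adj (mat_mult A B) i j = mat_mult (adj B) (adj A) i j"
    by (simp add: adj_def mat_mult_def mult.commute)
qed

section \<open>Norms from quadratic forms\<close>

text \<open>This is <A* A x, x> = |A x|^2 for a vector supported on the first \<open>n\<close> basis
  vectors. The sum over \<open>k\<close> is infinite because A x need not have finite
  support.\<close>

lemma star_mult_quadratic_form:
  assumes A: "form_bound A a"
  shows "(\<Sum>i<n. \<Sum>j<n. cnj (x i) * mat_mult (adj A) A i j * x j)
      = of_real (\<Sum>k. (cmod (\<Sum>j<n. A k j * x j))\<^sup>2)" (is "?Q = of_real (\<Sum>k. ?f k)")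
    and "summable (\<lambda>k. (cmod (\<Sum>j<n. A k j * x j))\<^sup>2)"
    and "(\<Sum>k. (cmod (\<Sum>j<n. A k j * x j))\<^sup>2) \<le> (a * l2norm x n)\<^sup>2"
proof -
  define v where "v k = (\<Sum>j<n. A k j * x j)" for k
  note b = l2_bound_comb_cols[OF A, of x n]
  show sm: "summable ?f"
    using l2_summable[OF b b] by (simp add: norm_mult power2_eq_square)
  show "(\<Sum>k. ?f k) \<le> (a * l2norm x n)\<^sup>2"
    using b by (intro suminf_le_const[OF sm])
      (auto simp: l2norm_power2[symmetric] l2_bound_def intro!: power_mono)
  have "of_real (\<Sum>k. ?f k) = (\<Sum>k. cnj (v k) * v k)"
    unfolding suminf_of_real[OF sm] complex_norm_square by (simp add: v_def mult.commute)
  also have "\<dots> = (\<Sum>k. \<Sum>i<n. \<Sum>j<n. cnj (x i) * (adj A i k * A k j) * x j)"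
  proof (intro arg_cong[where f=suminf] ext)
    fix k
    have "cnj (v k) * v k = (\<Sum>i<n. cnj (x i) * adj A i k) * (\<Sum>j<n. A k j * x j)"
      by (simp add: v_def adj_def mult.commute)
    then show "cnj (v k) * v k = (\<Sum>i<n. \<Sum>j<n. cnj (x i) * (adj A i k * A k j) * x j)"
      by (simp add: sum_product mult.assoc)
  qed
  also have "\<dots> = ?Q"
    unfolding mat_mult_def by (rule form_suminf[OF mat_mult_summable[OF form_bound_adj[OF A] A], symmetric])
  finally show "?Q = of_real (\<Sum>k. ?f k)" by simp
qed

text \<open>The nontrivial half of the C*-identity: |A x|^2 is the quadratic form of A* A at
  x.\<close>

lemma form_bound_star_mult:
  assumes A: "form_bound A a" and AA: "form_bound (mat_mult (adj A) A) c"
  shows "form_bound A (sqrt c)"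
proof (rule form_boundI)
  fix x m n
  let ?f = "\<lambda>k. (cmod (\<Sum>j<n. A k j * x j))\<^sup>2"
  note q = star_mult_quadratic_form[OF A, of x n]
  have "(l2norm (\<lambda>i. \<Sum>j<n. A i j * x j) m)\<^sup>2 \<le> (\<Sum>k. ?f k)"
    unfolding l2norm_power2 by (intro sum_le_suminf q(2)) auto
  also have "\<dots> = cmod (of_real (\<Sum>k. ?f k))"
    using suminf_nonneg[OF q(2)] by simp
  also have "\<dots> \<le> c * (l2norm x n * l2norm x n)"
    unfolding q(1)[symmetric] using form_boundD[OF AA, where y="\<lambda>i. cnj (x i)"] by simp
  also have "\<dots> = (sqrt c * l2norm x n)\<^sup>2"
    using form_bound_nonneg[OF AA] by (simp add: power_mult_distrib power2_eq_square)
  finally show "l2norm (\<lambda>i. \<Sum>j<n. A i j * x j) m \<le> sqrt c * l2norm x n"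
    by (rule power2_le_imp_le) (use form_bound_nonneg[OF AA] in auto)
qed (use form_bound_nonneg[OF AA] in auto)

text \<open>Polarisation: if \<open>w = B x\<close>, then \<open>4 \<parallel>w\<parallel>\<^sup>2 = q (w + x) - q (w - x) \<le> \<parallel>w + x\<parallel>\<^sup>2 \<le> 2 \<parallel>w\<parallel>\<^sup>2 + 2 \<parallel>x\<parallel>\<^sup>2\<close>
  for the quadratic form \<open>q\<close> of \<open>B\<close>.\<close>
lemma form_bound_one_of_quadratic_form:
  assumes adj: "adj B = B"
    and q: "\<And>x n. \<exists>s. 0 \<le> s \<and> s \<le> (l2norm x n)\<^sup>2 \<and> (\<Sum>i<n. \<Sum>j<n. cnj (x i) * B i j * x j) = of_real s"
  shows "form_bound B 1"
proof (rule form_boundI)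
  fix x0 :: "nat \<Rightarrow> complex" and m n :: nat
  \<comment> \<open>The quadratic form is given on square blocks only, so the \<open>m\<close> by
    \<open>n\<close> block is enlarged to \<open>N\<close> by \<open>N\<close>. Padding the vector
    with zeros changes neither its norm nor its image.\<close>
  define N where "N = max m n"
  define x where "x i = (if i < n then x0 i else 0)" for i :: nat
  define w where "w i = (\<Sum>j<N. B i j * x j)" for i
  define Q where "Q u v = (\<Sum>i<N. \<Sum>j<N. cnj (u i) * B i j * v j)" for u v
  have w_eq: "w = (\<lambda>i. \<Sum>j<n. B i j * x0 j)"
    unfolding w_def x_def N_def by (intro ext sum.mono_neutral_cong_right) auto
  have x_eq: "l2norm x N = l2norm x0 n"
    unfolding l2norm_def L2_set_def x_def N_def
    by (intro arg_cong[where f=sqrt] sum.mono_neutral_cong_right) auto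
  have Qwx: "Q w x = of_real ((l2norm w N)\<^sup>2)"
  proof -
    have "Q w x = (\<Sum>i<N. cnj (w i) * w i)"
      by (simp add: Q_def w_def[of "_"] sum_distrib_left mult.assoc del: cnj_sum)
    also have "\<dots> = (\<Sum>i<N. of_real ((cmod (w i))\<^sup>2))"
      by (intro sum.cong refl) (metis complex_norm_square mult.commute)
    finally show ?thesis by (simp add: l2norm_power2)
  qed
  have B: "cnj (B i j) = B j i" for i j
    using fun_cong[OF fun_cong[OF adj], of j i] by (simp add: adj_def)
  have "Q x w = cnj (Q w x)"
    unfolding Q_def by (subst sum.swap) (simp add: B mult_ac)
  then have Qxw: "Q x w = of_real ((l2norm w N)\<^sup>2)" by (simp add: Qwx)
  obtain s where s: "s \<le> (l2norm (\<lambda>i. w i + x i) N)\<^sup>2" "Q (\<lambda>i. w i + x i) (\<lambda>i. w i + x i) = of_real s"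
    using q[of "\<lambda>i. w i + x i" N] unfolding Q_def by blast
  obtain t where t: "0 \<le> t" "Q (\<lambda>i. w i - x i) (\<lambda>i. w i - x i) = of_real t"
    using q[of "\<lambda>i. w i - x i" N] unfolding Q_def by blast
  have "Q (\<lambda>i. w i + x i) (\<lambda>i. w i + x i) - Q (\<lambda>i. w i - x i) (\<lambda>i. w i - x i) = 2 * Q w x + 2 * Q x w"
    unfolding Q_def by (simp add: algebra_simps sum.distrib sum_subtractf)
  then have "complex_of_real (s - t) = of_real (4 * (l2norm w N)\<^sup>2)"
    by (simp add: s t Qwx Qxw)
  then have "4 * (l2norm w N)\<^sup>2 = s - t" unfolding of_real_eq_iff by simp
  also have "\<dots> \<le> (l2norm (\<lambda>i. w i + x i) N)\<^sup>2" using s t by simp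
  also have "\<dots> \<le> 2 * (l2norm w N)\<^sup>2 + 2 * (l2norm x N)\<^sup>2"
    unfolding l2norm_power2 sum_distrib_left sum.distrib[symmetric]
  proof (rule sum_mono)
    fix i
    have "(cmod (w i + x i))\<^sup>2 \<le> (cmod (w i) + cmod (x i))\<^sup>2"
      by (intro power_mono norm_triangle_ineq) auto
    also have "\<dots> \<le> 2 * (cmod (w i))\<^sup>2 + 2 * (cmod (x i))\<^sup>2"
       using sum_squares_bound[of "cmod (w i)" "cmod (x i)"] by (simp add: power2_sum)
    finally show "(cmod (w i + x i))\<^sup>2 \<le> 2 * (cmod (w i))\<^sup>2 + 2 * (cmod (x i))\<^sup>2" .
  qed
  finally have "(l2norm w N)\<^sup>2 \<le> (l2norm x N)\<^sup>2" by simp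
  then have "l2norm w N \<le> l2norm x N" by (rule power2_le_imp_le) simp
  moreover have "l2norm w m \<le> l2norm w N" by (rule l2norm_mono) (simp add: N_def)
  ultimately show "l2norm (\<lambda>i. \<Sum>j<n. B i j * x0 j) m \<le> 1 * l2norm x0 n"
    by (simp add: w_eq x_eq)
qed simp

lemma form_bound_id: "form_bound mat_id 1"
proof (rule form_boundI)
  fix x m n
  have "(\<Sum>j<n. mat_id i j * x j) = (if i < n then x i else 0)" for i
    by (simp add: mat_id_def if_distrib[of "\<lambda>t. t * _"] cong: if_cong)
  then have "(l2norm (\<lambda>i. \<Sum>j<n. mat_id i j * x j) m)\<^sup>2 = (\<Sum>i<m. if i < n then (cmod (x i))\<^sup>2 else 0)"
    unfolding l2norm_power2 by (intro sum.cong) auto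
  also have "\<dots> = (\<Sum>i\<in>{..<m} \<inter> {..<n}. (cmod (x i))\<^sup>2)"
    by (simp add: sum.inter_restrict)
  also have "\<dots> \<le> (l2norm x n)\<^sup>2"
    unfolding l2norm_power2 by (intro sum_mono2) auto
  finally show "l2norm (\<lambda>i. \<Sum>j<n. mat_id i j * x j) m \<le> 1 * l2norm x n"
    using power2_le_imp_le by fastforce
qed auto

lemma form_bound_zero: "form_bound (\<lambda>i j. 0) 0"
  by (simp add: form_bound_def)

section \<open>The operator norm and the Banach algebra of bounded matrices\<close>

definition mat_norm :: "mat \<Rightarrow> real" where
  "mat_norm A = Inf {c. form_bound A c}"

lemma mat_norm_le: "form_bound A c \<Longrightarrow> mat_norm A \<le> c"
  unfolding mat_norm_def
  by (rule cInf_lower) (auto intro!: bdd_belowI[where m=0] form_bound_nonneg)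

text \<open>The infimum is attained: every admissible constant is at least the quotient of the form
  by \<open>?k\<close>, hence so is the infimum. Where \<open>?k\<close> is 0 there is no quotient,
  and any admissible constant shows that the form vanishes.\<close>

lemma form_bound_mat_norm:
  assumes "bounded_mat A" shows "form_bound A (mat_norm A)"
proof -
  let ?S = "{c. form_bound A c}"
  have ne: "?S \<noteq> {}" using assms bounded_mat_iff by auto
  show ?thesis
    unfolding form_bound_def
  proof (intro conjI allI)
    show "0 \<le> mat_norm A"
      unfolding mat_norm_def by (rule cInf_greatest[OF ne]) (auto intro: form_bound_nonneg)
    fix x y m n
    let ?v = "cmod (\<Sum>i<m. \<Sum>j<n. y i * A i j * x j)" and ?k = "l2norm y m * l2norm x n"
    have le: "?v \<le> c * ?k" if "c \<in> ?S" for c using that form_boundD by auto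
    show "?v \<le> mat_norm A * ?k"
    proof (cases "?k = 0")
      case True
      then show ?thesis using ne le by force
    next
      case False
      then have k: "0 < ?k" by (simp add: less_le)
      have "?v / ?k \<le> mat_norm A"
        unfolding mat_norm_def
        by (rule cInf_greatest[OF ne]) (use le k in \<open>simp add: pos_divide_le_eq\<close>)
      then show ?thesis using k by (simp add: pos_divide_le_eq)
    qed
  qed
qed

text \<open>Associativity and distributivity of \<open>mat_mult\<close> depend on convergence. With
  boundedness in the type they become laws of a normed algebra, and the general theory of power
  series and Cauchy products applies. The algebra is real; complex coefficients are absorbed in
  \<open>ideal_sq_iff\<close>.\<close>

typedef bmat = "{A. bounded_mat A}" morphisms entry Abs_bmat
  using form_bound_zero bounded_mat_iff by blast

setup_lifting type_definition_bmat

lemma bounded_entry [simp]: "bounded_mat (entry x)"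
  using entry by simp

instantiation bmat :: real_normed_algebra_1
begin

lift_definition zero_bmat :: bmat is "\<lambda>i j. 0"
  using form_bound_zero bounded_mat_iff by blast

lift_definition one_bmat :: bmat is mat_id
  using form_bound_id bounded_mat_iff by blast

lift_definition plus_bmat :: "bmat \<Rightarrow> bmat \<Rightarrow> bmat" is "\<lambda>A B i j. A i j + B i j"
  using form_bound_add bounded_mat_iff by blast

lift_definition scaleR_bmat :: "real \<Rightarrow> bmat \<Rightarrow> bmat" is "\<lambda>r A i j. complex_of_real r * A i j"
  using form_bound_cmult bounded_mat_iff by blast

lift_definition times_bmat :: "bmat \<Rightarrow> bmat \<Rightarrow> bmat" is mat_mult
  using form_bound_mult bounded_mat_iff by blast

lift_definition norm_bmat :: "bmat \<Rightarrow> real" is mat_norm .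

definition uminus_bmat :: "bmat \<Rightarrow> bmat" where "uminus_bmat x = (-1) *\<^sub>R x"
definition minus_bmat :: "bmat \<Rightarrow> bmat \<Rightarrow> bmat" where "minus_bmat x y = x + - y"
definition dist_bmat :: "bmat \<Rightarrow> bmat \<Rightarrow> real" where "dist_bmat x y = norm (x - y)"
definition sgn_bmat :: "bmat \<Rightarrow> bmat" where "sgn_bmat x = inverse (norm x) *\<^sub>R x"
definition uniformity_bmat :: "(bmat \<times> bmat) filter" where
  "uniformity_bmat = (INF e\<in>{0<..}. principal {(x, y). dist x y < e})"
definition open_bmat :: "bmat set \<Rightarrow> bool" where
  "open_bmat U \<longleftrightarrow> (\<forall>x\<in>U. \<forall>\<^sub>F (x', y) in uniformity. x' = x \<longrightarrow> y \<in> U)"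

lemma entry_add: "entry (x + y) i j = entry x i j + entry y i j"
  by transfer simp

lemma entry_scaleR: "entry (r *\<^sub>R x) i j = complex_of_real r * entry x i j"
  by transfer simp

lemma entry_minus: "entry (- x) i j = - entry x i j"
  by (simp add: uminus_bmat_def entry_scaleR)

lemma entry_diff: "entry (x - y) i j = entry x i j - entry y i j"
  by (simp add: minus_bmat_def entry_add entry_minus)

lemma entry_zero: "entry 0 i j = 0"
  by transfer simp

lemma entry_one: "entry 1 i j = (if i = j then 1 else 0)"
  by transfer (simp add: mat_id_def)

lemma entry_mult: "entry (x * y) = mat_mult (entry x) (entry y)"
  by transfer simp

lemma form_bound_norm: "form_bound (entry x) (norm x)"
  by transfer (rule form_bound_mat_norm)

lemma norm_bmat_le: "form_bound (entry x) c \<Longrightarrow> norm x \<le> c"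
  by transfer (rule mat_norm_le)

lemma norm_entry_le: "cmod (entry x i j) \<le> norm x"
  by (rule form_bound_entry[OF form_bound_norm])

lemma bmat_eqI: "(\<And>i j. entry x i j = entry y i j) \<Longrightarrow> x = y"
  by (metis entry_inject ext)

lemma bmat_mult_summable: "summable (\<lambda>k. entry x i k * entry y k j)"
  by (rule mat_mult_summable[OF form_bound_norm form_bound_norm])

lemma entry_mult_sums: "(\<lambda>k. entry x i k * entry y k j) sums entry (x * y) i j"
  unfolding entry_mult mat_mult_def by (rule summable_sums[OF bmat_mult_summable])

instance
proof
  fix x y z :: bmat and r s :: real
  show "x - y = x + - y" by (simp add: minus_bmat_def)
  show "x + y + z = x + (y + z)" "x + y = y + x" "0 + x = x" "- x + x = 0"
    "r *\<^sub>R (x + y) = r *\<^sub>R x + r *\<^sub>R y" "(r + s) *\<^sub>R x = r *\<^sub>R x + s *\<^sub>R x"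
    "r *\<^sub>R s *\<^sub>R x = (r * s) *\<^sub>R x" "1 *\<^sub>R x = x"
    by (rule bmat_eqI; simp add: entry_add entry_scaleR entry_minus entry_zero algebra_simps)+
  show "x * y * z = x * (y * z)"
    by (rule entry_inject[THEN iffD1])
      (simp add: entry_mult mat_mult_assoc[OF form_bound_norm form_bound_norm form_bound_norm])
  show "1 * x = x"
  proof (rule bmat_eqI)
    fix i j
    have "(\<lambda>k. if k = i then entry x i j else 0) sums entry x i j" by (rule sums_single)
    moreover have "(\<lambda>k. if k = i then entry x i j else 0) = (\<lambda>k. entry 1 i k * entry x k j)"
      by (auto simp: entry_one)
    ultimately show "entry (1 * x) i j = entry x i j"
      using entry_mult_sums[of 1 i x j] sums_unique2 by metis
  qed
  show "x * 1 = x"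
  proof (rule bmat_eqI)
    fix i j
    have "(\<lambda>k. if k = j then entry x i j else 0) sums entry x i j" by (rule sums_single)
    moreover have "(\<lambda>k. if k = j then entry x i j else 0) = (\<lambda>k. entry x i k * entry 1 k j)"
      by (auto simp: entry_one)
    ultimately show "entry (x * 1) i j = entry x i j"
      using entry_mult_sums[of x i 1 j] sums_unique2 by metis
  qed
  show "(x + y) * z = x * z + y * z"
    by (intro bmat_eqI sums_unique2[OF entry_mult_sums])
      (simp add: entry_add distrib_right sums_add entry_mult_sums)
  show "x * (y + z) = x * y + x * z"
    by (intro bmat_eqI sums_unique2[OF entry_mult_sums])
      (simp add: entry_add distrib_left sums_add entry_mult_sums)
  show "r *\<^sub>R x * y = r *\<^sub>R (x * y)"
    by (intro bmat_eqI sums_unique2[OF entry_mult_sums])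
      (simp add: entry_scaleR mult.assoc sums_mult entry_mult_sums)
  show "x * r *\<^sub>R y = r *\<^sub>R (x * y)"
    by (intro bmat_eqI sums_unique2[OF entry_mult_sums])
      (simp add: entry_scaleR mult.left_commute sums_mult entry_mult_sums)
  show "(0::bmat) \<noteq> 1"
    using entry_zero[of 0 0] entry_one[of 0 0] by auto
  show "dist x y = norm (x - y)" by (simp add: dist_bmat_def)
  show "sgn x = inverse (norm x) *\<^sub>R x" by (simp add: sgn_bmat_def)
  show "norm (x + y) \<le> norm x + norm y"
    by (rule norm_bmat_le) (use form_bound_add[OF form_bound_norm form_bound_norm, of x y] in \<open>simp add: entry_add[abs_def]\<close>)
  have scale: "norm (r *\<^sub>R x) \<le> \<bar>r\<bar> * norm x" for r and x :: bmat
    by (rule norm_bmat_le)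
      (use form_bound_cmult[OF form_bound_norm, of "of_real r" x] in \<open>simp add: entry_scaleR[abs_def]\<close>)
  have norm0: "norm (0::bmat) = 0"
    using norm_bmat_le[of 0 0] form_bound_zero form_bound_nonneg[OF form_bound_norm[of 0]]
    by (simp add: entry_zero[abs_def])
  show "norm (r *\<^sub>R x) = \<bar>r\<bar> * norm x"
  proof (cases "r = 0")
    case True
    have "0 *\<^sub>R x = 0" by (rule bmat_eqI) (simp add: entry_scaleR entry_zero)
    then show ?thesis using True norm0 by simp
  next
    case False
    have "inverse r *\<^sub>R (r *\<^sub>R x) = x"
      using False by (intro bmat_eqI) (simp add: entry_scaleR)
    then have "norm x \<le> \<bar>inverse r\<bar> * norm (r *\<^sub>R x)"
      using scale[of "inverse r" "r *\<^sub>R x"] by simp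
    then have "\<bar>r\<bar> * norm x \<le> norm (r *\<^sub>R x)"
      using False by (simp add: abs_inverse field_simps)
    then show ?thesis using scale[of r x] by simp
  qed
  show "(norm x = 0) = (x = 0)"
  proof
    assume "norm x = 0"
    then show "x = 0" using norm_entry_le[of x] by (intro bmat_eqI) (simp add: entry_zero)
  qed (simp add: norm0)
  show "norm (x * y) \<le> norm x * norm y"
    unfolding entry_mult using form_bound_mult[OF form_bound_norm form_bound_norm, of x y]
    by (intro norm_bmat_le) (simp add: entry_mult)
  have "norm (1::bmat) \<le> 1"
    by (rule norm_bmat_le) (transfer, rule form_bound_id)
  then show "norm (1::bmat) = 1"
    using norm_entry_le[of 1 0 0] by (simp add: entry_one)
qed (simp_all add: uniformity_bmat_def open_bmat_def)

end

lemma tendsto_entry: "(X \<longlongrightarrow> x) F \<Longrightarrow> ((\<lambda>n. entry (X n) i j) \<longlongrightarrow> entry x i j) F"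
proof -
  have "bounded_linear (\<lambda>x. entry x i j)"
    by (rule bounded_linear_intro[where K=1])
      (auto simp: entry_add entry_scaleR scaleR_conv_of_real[where 'a=complex] norm_entry_le)
  then show "(X \<longlongrightarrow> x) F \<Longrightarrow> ((\<lambda>n. entry (X n) i j) \<longlongrightarrow> entry x i j) F"
    by (rule bounded_linear.tendsto)
qed

text \<open>Closed balls are closed under entrywise limits. This serves both completeness and the
  weak limits in the factorisation.\<close>

lemma entry_lim_obtain:
  assumes "\<And>n::nat. norm (X n) \<le> M" and "\<And>i j. (\<lambda>n. entry (X n) i j) \<longlonglongrightarrow> B i j"
  obtains x where "entry x = B" and "norm x \<le> M"
proof -
  have "form_bound (entry (X n)) M" for n
    using form_boundD[OF form_bound_norm[of "X n"]] assms(1)[of n] order_trans[OF norm_ge_zero assms(1)[of n]]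
    unfolding form_bound_def
    by (meson mult_right_mono mult_nonneg_nonneg l2norm_nonneg order_trans)
  then have B: "form_bound B M" by (rule form_bound_lim[OF _ assms(2)])
  then have "entry (Abs_bmat B) = B" using bounded_mat_iff by (auto intro!: Abs_bmat_inverse)
  with B norm_bmat_le that show thesis by metis
qed

text \<open>Entries of a Cauchy sequence converge because they are dominated by the norm.
  Convergence in norm follows since \<open>X m - x\<close> is an entrywise limit of differences
  lying in a small closed ball.\<close>

instance bmat :: banach
proof
  fix X :: "nat \<Rightarrow> bmat" assume X: "Cauchy X"
  have "Cauchy (\<lambda>n. entry (X n) i j)" for i j
    using X unfolding Cauchy_def dist_norm entry_diff[symmetric]
    by (meson norm_entry_le order_le_less_trans)
  then obtain B where B: "\<And>i j. (\<lambda>n. entry (X n) i j) \<longlonglongrightarrow> B i j"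
    unfolding Cauchy_convergent_iff convergent_def by metis
  obtain M where "\<And>n. norm (X n) \<le> M"
    using Cauchy_Bseq[OF X] by (auto simp: Bseq_def)
  then obtain x where x: "entry x = B" using entry_lim_obtain[OF _ B] by blast
  have "X \<longlonglongrightarrow> x"
  proof (rule metric_LIMSEQ_I)
    fix e :: real assume "0 < e"
    then obtain N where N: "\<And>m n. m \<ge> N \<Longrightarrow> n \<ge> N \<Longrightarrow> norm (X m - X n) < e / 2"
      using X unfolding Cauchy_def dist_norm by (meson half_gt_zero)
    have "dist (X m) x < e" if "m \<ge> N" for m
    proof -
      have 1: "norm (X m - X (n + N)) \<le> e / 2" for n using N[OF that, of "n + N"] by simp
      have 2: "(\<lambda>n. entry (X m - X (n + N)) i j) \<longlonglongrightarrow> entry (X m - x) i j" for i j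
        unfolding entry_diff x by (intro tendsto_intros LIMSEQ_ignore_initial_segment B)
      obtain y where "entry y = entry (X m - x)" "norm y \<le> e / 2"
        using entry_lim_obtain[OF 1 2] by blast
      then show ?thesis using \<open>0 < e\<close> by (simp add: entry_inject dist_norm)
    qed
    then show "\<exists>no. \<forall>n\<ge>no. dist (X n) x < e" by blast
  qed
  then show "convergent X" by (auto simp: convergent_def)
qed

section \<open>The C*-algebra of bounded matrices\<close>

lift_definition star :: "bmat \<Rightarrow> bmat" is adj
  using form_bound_adj bounded_mat_iff by blast

lemma entry_star: "entry (star x) = adj (entry x)"
  by transfer simp

lemma star_star [simp]: "star (star x) = x"
  by (rule bmat_eqI) (simp add: entry_star adj_def)

lemma star_add: "star (x + y) = star x + star y"
  by (rule bmat_eqI) (simp add: entry_star adj_def entry_add)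

lemma star_scaleR: "star (r *\<^sub>R x) = r *\<^sub>R star x"
  by (rule bmat_eqI) (simp add: entry_star adj_def entry_scaleR)

lemma star_minus: "star (- x) = - star x"
  using star_scaleR[of "-1" x] by simp

lemma star_diff: "star (x - y) = star x - star y"
  using star_add[of x "- y"] by (simp add: star_minus)

lemma star_one [simp]: "star 1 = 1"
  by (rule bmat_eqI) (simp add: entry_star adj_def entry_one)

lemma star_mult: "star (x * y) = star y * star x"
  by (rule entry_inject[THEN iffD1])
    (simp add: entry_mult entry_star adj_mat_mult[OF form_bound_norm form_bound_norm])

lemma star_power: "star (x ^ n) = star x ^ n"
  by (induction n) (simp_all add: star_mult power_commutes)

lemma norm_star [simp]: "norm (star x) = norm x"
proof -
  have "norm (star x) \<le> norm x" for x
    by (rule norm_bmat_le) (simp add: entry_star form_bound_adj form_bound_norm)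
  from this[of x] this[of "star x"] show ?thesis by simp
qed

lemma bounded_linear_star: "bounded_linear star"
  by (rule bounded_linear_intro[where K=1]) (auto simp: star_add star_scaleR)

lemma norm_power2_le_star_mult: "(norm x)\<^sup>2 \<le> norm (star x * x)"
proof -
  have "norm x \<le> sqrt (norm (star x * x))"
    using form_bound_norm[of "star x * x"]
    by (intro norm_bmat_le form_bound_star_mult[OF form_bound_norm]) (simp add: entry_mult entry_star)
  then have "(norm x)\<^sup>2 \<le> (sqrt (norm (star x * x)))\<^sup>2" by (rule power_mono) simp
  then show ?thesis by simp
qed

text \<open>The C*-identity. Below, norms of \<open>u\<close>, \<open>w\<close> and \<open>h\<close>
  are found by computing a product of this kind.\<close>

lemma norm_star_mult: "norm (star x * x) = (norm x)\<^sup>2"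
  using norm_power2_le_star_mult[of x] norm_mult_ineq[of "star x" x] by (simp add: power2_eq_square)

text \<open>The quadratic form of the left side is |x|^2 - |y x|^2, which lies between 0 and |x|^2.
  Thus p = y* y satisfies the condition under which square root and resolvents are expanded in
  powers of 1 - p.\<close>

lemma norm_one_minus_star_mult:
  assumes "norm y \<le> 1" shows "norm (1 - star y * y) \<le> 1"
proof (rule norm_bmat_le, rule form_bound_one_of_quadratic_form)
  show "adj (entry (1 - star y * y)) = entry (1 - star y * y)"
    unfolding entry_star[symmetric] by (simp add: star_diff star_mult)
  fix x n
  have y: "form_bound (entry y) (norm y)" by (rule form_bound_norm)
  note q = star_mult_quadratic_form[OF y, of x n]
  let ?s = "\<Sum>k. (cmod (\<Sum>j<n. entry y k j * x j))\<^sup>2"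
  have one: "(\<Sum>i<n. \<Sum>j<n. cnj (x i) * entry 1 i j * x j) = of_real ((l2norm x n)\<^sup>2)"
  proof -
    have "(\<Sum>j<n. cnj (x i) * entry 1 i j * x j) = of_real ((cmod (x i))\<^sup>2)" if "i < n" for i
    proof -
      have "(\<Sum>j<n. cnj (x i) * entry 1 i j * x j) = (\<Sum>j<n. if i = j then cnj (x i) * x j else 0)"
        by (intro sum.cong) (auto simp: entry_one)
      also have "\<dots> = cnj (x i) * x i" using that by simp
      finally show ?thesis by (metis complex_norm_square mult.commute)
    qed
    then show ?thesis by (simp add: l2norm_power2)
  qed
  have "?s \<le> (norm y * l2norm x n)\<^sup>2" by (rule q(3))
  also have "\<dots> \<le> (l2norm x n)\<^sup>2"
    using assms by (intro power_mono mult_left_le_one_le) auto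
  finally have "?s \<le> (l2norm x n)\<^sup>2" .
  moreover have "0 \<le> ?s" by (rule suminf_nonneg[OF q(2)]) simp
  moreover have "(\<Sum>i<n. \<Sum>j<n. cnj (x i) * entry (1 - star y * y) i j * x j) = of_real ((l2norm x n)\<^sup>2 - ?s)"
    using q(1) one
    by (simp add: entry_diff entry_mult entry_star right_diff_distrib left_diff_distrib sum_subtractf)
  ultimately show "\<exists>s. 0 \<le> s \<and> s \<le> (l2norm x n)\<^sup>2 \<and>
      (\<Sum>i<n. \<Sum>j<n. cnj (x i) * entry (1 - star y * y) i j * x j) = of_real s"
    by (intro exI[of _ "(l2norm x n)\<^sup>2 - ?s"]) simp
qed

section \<open>Square roots by the binomial series\<close>

text \<open>The Taylor coefficients of sqrt (1 - x) at 0.\<close>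

definition sqrt_coeff :: "nat \<Rightarrow> real" where
  "sqrt_coeff n = ((1/2) gchoose n) * (-1) ^ n"

lemma sqrt_coeff_0 [simp]: "sqrt_coeff 0 = 1"
  by (simp add: sqrt_coeff_def)

text \<open>The numerator is the product of 1/2 - i over i = 0..n. Its first factor is positive and
  the other n are negative, so of the n + 1 signs in the definition exactly one survives.\<close>

lemma sqrt_coeff_Suc_nonpos: "sqrt_coeff (Suc n) \<le> 0"
proof -
  have "(\<Prod>i=1..n. 1 / 2 - real i) * (-1) ^ n = (\<Prod>i=1..n. real i - 1 / 2)"
    by (induction n) (simp_all add: algebra_simps)
  moreover have "(\<Prod>i=1..n. real i - 1 / 2) \<ge> 0"
    by (intro prod_nonneg) auto
  ultimately have "(\<Prod>i=1..n. 1 / 2 - real i) * (-1) ^ n \<ge> 0" by simp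
  moreover have "sqrt_coeff (Suc n) = - ((\<Prod>i=1..n. 1 / 2 - real i) * (-1) ^ n) / (2 * fact (Suc n))"
  proof -
    have eq: "(\<Prod>i=0..n. 1 / 2 - real i) = 1 / 2 * (\<Prod>i=1..n. 1 / 2 - real i)"
      by (subst prod.atLeast_Suc_atMost) auto
    show ?thesis
      unfolding sqrt_coeff_def gbinomial_prod_rev atLeastLessThanSuc_atLeastAtMost eq
      by (simp del: fact_Suc)
  qed
  ultimately show ?thesis
    by (simp add: divide_nonpos_nonneg)
qed

text \<open>Letting \<open>x\<close> tend to 1 in \<open>sqrt (1 - x) = 1 - (\<Sum>n. \<bar>c\<^sub>n\<bar> x ^ n)\<close> bounds the sum of the
  absolute values, so the series converges on the closed unit ball of a Banach algebra.\<close>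
lemma summable_sqrt_coeff: "summable (\<lambda>n. \<bar>sqrt_coeff n\<bar>)"
proof -
  have bnd: "(\<Sum>i<n. - sqrt_coeff (Suc i)) \<le> 1" for n
  proof (rule tendsto_upperbound)
    show "((\<lambda>x. \<Sum>i<n. - sqrt_coeff (Suc i) * x ^ Suc i) \<longlongrightarrow> (\<Sum>i<n. - sqrt_coeff (Suc i))) (at_left 1)"
      by (rule tendsto_eq_intros refl | simp)+
    show "\<forall>\<^sub>F x in at_left 1. (\<Sum>i<n. - sqrt_coeff (Suc i) * x ^ Suc i) \<le> 1"
      unfolding eventually_at_left_field
    proof (intro exI[of _ 0] conjI allI impI)
      fix x :: real assume x: "0 < x" "x < 1"
      have "(\<lambda>n. ((1/2) gchoose n) * (- x) ^ n) sums (1 + - x) powr (1/2)"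
        by (rule gen_binomial_real) (use x in auto)
      then have s: "(\<lambda>n. sqrt_coeff n * x ^ n) sums (1 - x) powr (1/2)"
        by (simp add: sqrt_coeff_def power_minus[of x] mult_ac)
      then have "(\<lambda>n. sqrt_coeff (Suc n) * x ^ Suc n) sums ((1 - x) powr (1/2) - 1)"
        by (subst sums_Suc_iff) simp
      then have s': "(\<lambda>n. - sqrt_coeff (Suc n) * x ^ Suc n) sums (1 - (1 - x) powr (1/2))"
        using sums_minus by fastforce
      have "(\<Sum>i<n. - sqrt_coeff (Suc i) * x ^ Suc i) \<le> (\<Sum>i. - sqrt_coeff (Suc i) * x ^ Suc i)"
        using x sqrt_coeff_Suc_nonpos
        by (intro sum_le_suminf sums_summable[OF s']) (auto simp: mult_nonpos_nonneg)
      also have "\<dots> \<le> 1" unfolding sums_unique[OF s', symmetric] by simp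
      finally show "(\<Sum>i<n. - sqrt_coeff (Suc i) * x ^ Suc i) \<le> 1" .
    qed simp
  qed simp
  have "summable (\<lambda>n. \<bar>sqrt_coeff (Suc n)\<bar>)"
    using bnd sqrt_coeff_Suc_nonpos by (intro summableI_nonneg_bounded[where x=1]) (simp_all add: abs_of_nonpos)
  then show ?thesis by (rule summable_Suc_iff[THEN iffD1])
qed

text \<open>The coefficients of sqrt (1 - x)^2 = 1 - x, read off from Vandermonde's identity with
  1/2 + 1/2 = 1.\<close>

lemma sqrt_coeff_convolution:
  "(\<Sum>i\<le>k. sqrt_coeff i * sqrt_coeff (k - i)) = (if k = 0 then 1 else if k = 1 then -1 else 0)"
proof -
  have "(\<Sum>i\<le>k. sqrt_coeff i * sqrt_coeff (k - i))
      = (-1) ^ k * (\<Sum>i\<in>{0..k}. ((1/2) gchoose i) * ((1/2) gchoose (k - i)))"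
    unfolding sum_distrib_left atMost_atLeast0
    by (intro sum.cong refl) (simp add: sqrt_coeff_def power_add[symmetric] mult_ac)
  also have "\<dots> = (-1) ^ k * (1 gchoose k)"
    by (subst gbinomial_Vandermonde) simp
  also have "(1::real) gchoose k = of_nat (1 choose k)"
    by (simp add: binomial_gbinomial)
  finally show ?thesis
    by (cases "k \<le> 1") (auto simp: le_Suc_eq binomial_eq_0)
qed

text \<open>The series of sqrt (1 - q) at q = 1 - p, where \<open>norm q\<close> may equal 1 because
  the coefficients are absolutely summable. Real coefficients make \<open>h\<close> self-adjoint,
  and the convolution identity evaluates its square to 1 - q.\<close>

lemma ex_sqrt:
  assumes "star p = p" and "norm (1 - p) \<le> 1"
  obtains h where "star h = h" and "h * h = p"
proof
  define q where "q = 1 - p"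
  define f where "f n = sqrt_coeff n *\<^sub>R q ^ n" for n
  have "norm (q ^ n) \<le> 1" for n
    using norm_power_ineq[of q n] power_le_one[of "norm q" n] assms(2) by (simp add: q_def)
  then have "norm (f n) \<le> \<bar>sqrt_coeff n\<bar>" for n
    by (simp add: f_def mult_left_le)
  then have sm: "summable (\<lambda>n. norm (f n))"
    using summable_comparison_test'[OF summable_sqrt_coeff, of 0 "\<lambda>n. norm (f n)"] by simp
  show "star (\<Sum>n. f n) = (\<Sum>n. f n)"
    using bounded_linear.suminf[OF bounded_linear_star summable_norm_cancel[OF sm]]
    by (simp add: f_def star_scaleR star_power q_def star_diff assms(1))
  have conv: "(\<Sum>i\<le>k. f i * f (k - i)) = (if k = 0 then 1 else if k = 1 then - q else 0)" for k
  proof -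
    have "(\<Sum>i\<le>k. f i * f (k - i)) = (\<Sum>i\<le>k. (sqrt_coeff i * sqrt_coeff (k - i)) *\<^sub>R q ^ k)"
      by (intro sum.cong refl) (simp add: f_def power_add[symmetric])
    then show ?thesis
      unfolding scaleR_sum_left[symmetric] sqrt_coeff_convolution by simp
  qed
  have "(\<lambda>k. \<Sum>i\<le>k. f i * f (k - i)) sums (\<Sum>k<2. \<Sum>i\<le>k. f i * f (k - i))"
    by (rule sums_finite) (auto simp: conv)
  then have "(\<Sum>n. f n) * (\<Sum>n. f n) = (\<Sum>k<2. \<Sum>i\<le>k. f i * f (k - i))"
    using Cauchy_product_sums[OF sm sm] sums_unique2 by blast
  then show "(\<Sum>n. f n) * (\<Sum>n. f n) = p"
    by (simp add: conv numeral_2_eq_2 q_def)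
qed

section \<open>Resolvents, weak limits and factorisation\<close>

text \<open>A Neumann series: p + e = (1 + e) (1 - z) with \<open>norm z\<close> at most 1 / (1 +
  e), so the inverse of 1 - z has norm at most (1 + e) / e. Self-adjointness passes from
  \<open>p + e *\<^sub>R 1\<close> to its inverse.\<close>

lemma ex_resolvent:
  assumes p: "star p = p" "norm (1 - p) \<le> 1" and "0 < e"
  obtains r where "r * (p + e *\<^sub>R 1) = 1" "(p + e *\<^sub>R 1) * r = 1" "star r = r" "norm r \<le> 1 / e"
proof -
  define z where "z = (1 / (1 + e)) *\<^sub>R (1 - p)"
  have nz: "norm z \<le> 1 / (1 + e)"
    using p(2) \<open>0 < e\<close> by (simp add: z_def divide_simps)
  also have "\<dots> < 1" using \<open>0 < e\<close> by simp
  finally have nz1: "norm z < 1" .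
  define s where "s = (\<Sum>n. z ^ n)"
  have sm: "summable (\<lambda>n. z ^ n)" by (rule complete_algebra_summable_geometric[OF nz1])
  have "s = 1 + (\<Sum>n. z ^ Suc n)"
    unfolding s_def using suminf_split_head[OF sm] by simp
  moreover have "(\<Sum>n. z ^ Suc n) = z * s" "(\<Sum>n. z ^ Suc n) = s * z"
    unfolding s_def using suminf_mult[OF sm, of z] suminf_mult2[OF sm, of z] by (simp_all add: power_commutes)
  ultimately have inv: "(1 - z) * s = 1" "s * (1 - z) = 1"
    by (simp_all add: algebra_simps) 
  have smn: "summable (\<lambda>n. norm z ^ n)" using nz1 by (intro summable_geometric) simp
  have "norm s \<le> (\<Sum>n. norm z ^ n)"
    unfolding s_def
    by (intro order_trans[OF summable_norm suminf_le] summable_comparison_test'[OF smn, of 0] smn)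
      (auto simp: norm_power_ineq)
  also have "\<dots> = 1 / (1 - norm z)" using nz1 by (simp add: suminf_geometric)
  also have "\<dots> \<le> (1 + e) / e"
    using nz nz1 \<open>0 < e\<close> by (simp add: divide_simps) (simp add: algebra_simps)
  finally have ns: "norm s \<le> (1 + e) / e" .
  define r where "r = (1 / (1 + e)) *\<^sub>R s"
  have pe: "p + e *\<^sub>R 1 = (1 + e) *\<^sub>R (1 - z)"
    using \<open>0 < e\<close> by (simp add: z_def algebra_simps)
  have r1: "r * (p + e *\<^sub>R 1) = 1" and r2: "(p + e *\<^sub>R 1) * r = 1"
    unfolding pe r_def using \<open>0 < e\<close> inv by simp_all
  have sp: "star (p + e *\<^sub>R 1) = p + e *\<^sub>R 1"
    by (simp add: star_add star_scaleR p)
  have "star r = star r * ((p + e *\<^sub>R 1) * r)" by (simp add: r2)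
  also have "\<dots> = star ((p + e *\<^sub>R 1) * r) * r"
    by (simp add: star_mult sp mult.assoc[symmetric])
  finally have r3: "star r = r" by (simp add: r2)
  have "norm r \<le> 1 / e"
    using ns \<open>0 < e\<close> by (simp add: r_def divide_simps) 
  with r1 r2 r3 that show thesis by blast
qed

text \<open>The entries of \<open>u n\<close> are bounded by \<open>M\<close> and indexed by
  countably many pairs, so a diagonal subsequence converges entrywise. Its limit \<open>v\<close> is
  bounded, and each entry of \<open>u n * y\<close> pairs a row of \<open>u n\<close> with a fixed
  column of \<open>y\<close>, so it follows to the limit.\<close>

lemma weak_limit_left_factor:
  fixes u :: "nat \<Rightarrow> bmat"
  assumes "\<And>n. norm (u n) \<le> M" and "(\<lambda>n. u n * y) \<longlonglongrightarrow> x"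
  obtains v where "x = v * y"
proof -
  obtain k :: "nat \<Rightarrow> nat" where k: "strict_mono k"
    and kl: "\<And>ij. \<exists>l. (\<lambda>n. entry (u (k n)) (fst ij) (snd ij)) \<longlonglongrightarrow> l"
  proof (rule function_convergent_subsequence[of UNIV "\<lambda>n ij. entry (u n) (fst ij) (snd ij)" M])
    show "cmod (entry (u n) (fst ij) (snd ij)) \<le> M" for n ij
      by (rule order_trans[OF norm_entry_le assms(1)])
  qed (auto intro: that)
  then obtain L' where L': "\<And>ij. (\<lambda>n. entry (u (k n)) (fst ij) (snd ij)) \<longlonglongrightarrow> L' ij"
    by metis
  define L where "L i j = L' (i, j)" for i j
  have L: "(\<lambda>n. entry (u (k n)) i j) \<longlonglongrightarrow> L i j" for i j
    using L'[of "(i, j)"] by (simp add: L_def)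
  obtain v where v: "entry v = L" "norm v \<le> M"
    using entry_lim_obtain[OF assms(1) L] by blast
  have "x = v * y"
  proof (rule bmat_eqI)
    fix i j
    have "(\<lambda>n. \<Sum>l. entry (u (k n)) i l * entry y l j) \<longlonglongrightarrow> (\<Sum>l. entry v i l * entry y l j)"
    proof (rule l2_weak_lim)
      show "l2_bound (\<lambda>l. entry (u (k n)) i l) M" for n
        using l2_bound_row[OF form_bound_norm, of "u (k n)" i] assms(1)[of "k n"]
        unfolding l2_bound_def by (meson order_trans)
      show "l2_bound (\<lambda>l. entry y l j) (norm y)"
        by (rule l2_bound_col[OF form_bound_norm])
    qed (simp add: v L)
    then have "(\<lambda>n. entry (u (k n) * y) i j) \<longlonglongrightarrow> entry (v * y) i j"
      by (simp add: entry_mult mat_mult_def)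
    moreover have "(\<lambda>n. entry (u (k n) * y) i j) \<longlonglongrightarrow> entry x i j"
      using LIMSEQ_subseq_LIMSEQ[OF tendsto_entry[OF assms(2)] k] by (simp add: o_def)
    ultimately show "entry x i j = entry (v * y) i j" by (rule LIMSEQ_unique[rotated])
  qed
  then show thesis by (rule that)
qed

text \<open>Douglas' factorisation lemma; the factor is a weak limit of \<open>x (y\<^sup>*y + e)\<inverse> y\<^sup>*\<close> for \<open>e \<rightarrow> 0\<close>.\<close>
lemma factor_through_equal_modulus:
  assumes xy: "star x * x = star y * y" and y: "norm y \<le> 1"
  obtains v where "x = v * y"
proof -
  define p where "p = star y * y"
  \<comment> \<open>The companion of \<open>p\<close> on the other side: \<open>star u * u\<close>
    will contain \<open>y * r * star y\<close>, which is evaluated by moving the resolvent of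
    \<open>p\<close> across \<open>y\<close>, where it becomes that of \<open>p'\<close>.\<close>
  define p' where "p' = y * star y"
  have p: "star p = p" "norm (1 - p) \<le> 1"
    using norm_one_minus_star_mult[OF y] by (simp_all add: p_def star_mult)
  have p': "star p' = p'" "norm (1 - p') \<le> 1"
    using norm_one_minus_star_mult[of "star y"] y by (simp_all add: p'_def star_mult)
  have approx: "\<exists>u. norm u \<le> 2 \<and> norm (u * y - x) \<le> sqrt (2 * e)" if e: "0 < e" for e
  proof -
    obtain r where r: "r * (p + e *\<^sub>R 1) = 1" "(p + e *\<^sub>R 1) * r = 1" "star r = r" "norm r \<le> 1 / e"
      using ex_resolvent[OF p e] by blast
    obtain r' where r': "r' * (p' + e *\<^sub>R 1) = 1" "(p' + e *\<^sub>R 1) * r' = 1" "star r' = r'" "norm r' \<le> 1 / e"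
      using ex_resolvent[OF p' e] by blast
    have rp: "r * p = 1 - e *\<^sub>R r" "p * r = 1 - e *\<^sub>R r" 
      using r(1,2) by (simp_all add: algebra_simps)
    have rp': "r' * p' = 1 - e *\<^sub>R r'" using r'(1) by (simp add: algebra_simps)
    \<comment> \<open>Triangle inequality, as \<open>norm (e *\<^sub>R r)\<close> is at most 1. What
      counts is that the bound does not depend on \<open>e\<close>.\<close>
    have nr: "norm (1 - e *\<^sub>R r) \<le> 2"
      using norm_triangle_ineq4[of 1 "e *\<^sub>R r"] r(4) \<open>0 < e\<close> by (simp add: field_simps)
    have nr': "norm (1 - e *\<^sub>R r') \<le> 2"
      using norm_triangle_ineq4[of 1 "e *\<^sub>R r'"] r'(4) \<open>0 < e\<close> by (simp add: field_simps)
    define u where "u = x * r * star y"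
    \<comment> \<open>The push-through identity: y (y* y + e)^-1 = (y y* + e)^-1 y, from y p = p'
      y.\<close>
    have "y * r = r' * (p' + e *\<^sub>R 1) * y * r" by (simp add: r')
    also have "\<dots> = r' * y * ((p + e *\<^sub>R 1) * r)" by (simp add: p_def p'_def algebra_simps)
    finally have push: "y * r = r' * y" by (simp add: r)
    have "star u * u = y * r * (star x * x) * r * star y"
      by (simp add: u_def star_mult r mult.assoc)
    also have "\<dots> = (y * r * star y) * (y * r * star y)"
      by (simp add: xy mult.assoc)
    also have "y * r * star y = 1 - e *\<^sub>R r'"
      by (simp add: push mult.assoc rp' flip: p'_def)
    finally have "norm (star u * u) \<le> 2 * 2"
      using norm_mult_ineq[of "1 - e *\<^sub>R r'" "1 - e *\<^sub>R r'"] mult_mono[OF nr' nr'] by simp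
    then have "(norm u)\<^sup>2 \<le> 2\<^sup>2" by (simp add: norm_star_mult)
    then have nu: "norm u \<le> 2" by (rule power2_le_imp_le) simp
    \<comment> \<open>Since r p = 1 - e r, the error is -e x r. In \<open>star w * w\<close> the
      factor e^2 meets a single r of norm at most 1/e, next to 1 - e r of norm at most 2, which
      leaves 2 e.\<close>
    define w where "w = u * y - x"
    have w: "w = - (e *\<^sub>R (x * r))"
      by (simp add: w_def u_def mult.assoc rp right_diff_distrib flip: p_def)
    have "star w * w = (e * e) *\<^sub>R (r * (star x * x) * r)"
      by (simp add: w star_minus star_scaleR star_mult r mult.assoc)
    also have "r * (star x * x) * r = (1 - e *\<^sub>R r) * r"
      by (simp add: xy rp flip: p_def)
    finally have "norm (star w * w) = e * e * norm ((1 - e *\<^sub>R r) * r)" by simp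
    also have "\<dots> \<le> e * e * (2 * (1 / e))"
      using nr r(4) \<open>0 < e\<close> by (intro mult_left_mono order_trans[OF norm_mult_ineq] mult_mono) auto
    also have "\<dots> = 2 * e" using \<open>0 < e\<close> by simp
    finally have "norm w \<le> sqrt (2 * e)"
      unfolding norm_star_mult by (rule real_le_rsqrt)
    with nu show ?thesis unfolding w_def by blast
  qed
  have "\<forall>n. \<exists>u. norm u \<le> 2 \<and> norm (u * y - x) \<le> sqrt (2 * (1 / Suc n))"
    by (intro allI approx) simp
  from choice[OF this] obtain u
    where u: "\<And>n. norm (u n) \<le> 2" "\<And>n. norm (u n * y - x) \<le> sqrt (2 * (1 / Suc n))"
    by blast
  have "(\<lambda>n. sqrt (2 * (1 / Suc n))) \<longlonglongrightarrow> sqrt (2 * 0)"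
    by (intro tendsto_intros lim_inverse_n'[THEN LIMSEQ_Suc])
  then have lim: "(\<lambda>n. sqrt (2 * (1 / Suc n))) \<longlonglongrightarrow> 0" by (simp only: mult_zero_right real_sqrt_zero)
  have "(\<lambda>n. u n * y - x) \<longlonglongrightarrow> 0"
    by (rule Lim_null_comparison[OF _ lim]) (rule always_eventually, rule allI, rule u(2))
  then have "(\<lambda>n. u n * y) \<longlonglongrightarrow> x" by (rule LIM_zero_cancel)
  from weak_limit_left_factor[where u=u, OF u(1) this] that show thesis by blast
qed

text \<open>After scaling \<open>y\<close> into the unit ball, the C*-identity puts \<open>h\<close>
  there as well, so the factorisation applies in both directions. The scalar is moved into the
  factors at the end.\<close>

lemma self_adjoint_factor:
  obtains h u v where "star h = h" "y = u * h" "h = v * y"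
proof -
  \<comment> \<open>The added 1 keeps \<open>c\<close> positive when \<open>y\<close> is 0.\<close>
  define c where "c = norm y + 1"
  have c: "0 < c" by (simp add: c_def add_nonneg_pos)
  define y1 where "y1 = (1 / c) *\<^sub>R y"
  have y1: "norm y1 \<le> 1" using c by (simp add: y1_def) (simp add: c_def)
  obtain h where h: "star h = h" "h * h = star y1 * y1"
    using ex_sqrt[of "star y1 * y1"] norm_one_minus_star_mult[OF y1] by (metis star_mult star_star)
  then have eq: "star h * h = star y1 * y1" by simp
  then have "(norm h)\<^sup>2 = (norm y1)\<^sup>2" by (metis norm_star_mult)
  then have "norm h \<le> 1" using y1 by (simp add: power2_eq_iff_nonneg)
  then obtain u where u: "y1 = u * h" using factor_through_equal_modulus[OF eq[symmetric]] by blast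
  obtain v where v: "h = v * y1" using factor_through_equal_modulus[OF eq y1] by blast
  have "y = c *\<^sub>R y1" using c by (simp add: y1_def)
  then have "y = (c *\<^sub>R u) * h" using u by simp
  moreover have "h = ((1 / c) *\<^sub>R v) * y" using v by (simp add: y1_def)
  ultimately show thesis using h(1) that by blast
qed

section \<open>Ideals and their squares\<close>

lemma entry_sum: "entry (\<Sum>k\<in>A. f k) i j = (\<Sum>k\<in>A. entry (f k) i j)"
  by (induction A rule: infinite_finite_induct) (simp_all add: entry_zero entry_add)

lemma ideal_obtain_entry:
  assumes "operator_ideal J" "X \<in> J" obtains x where "X = entry x"
  using assms Abs_bmat_inverse[of X] by (metis operator_ideal_def subsetD)

lemma ideal_add: "operator_ideal J \<Longrightarrow> entry x \<in> J \<Longrightarrow> entry y \<in> J \<Longrightarrow> entry (x + y) \<in> J"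
  by (simp add: operator_ideal_def entry_add[abs_def])

lemma ideal_zero: "operator_ideal J \<Longrightarrow> entry 0 \<in> J"
  by (simp add: operator_ideal_def entry_zero[abs_def])

lemma ideal_mult_left: "operator_ideal J \<Longrightarrow> entry x \<in> J \<Longrightarrow> entry (a * x) \<in> J"
  by (simp add: operator_ideal_def entry_mult)

lemma ideal_mult_right: "operator_ideal J \<Longrightarrow> entry x \<in> J \<Longrightarrow> entry (x * a) \<in> J"
  by (simp add: operator_ideal_def entry_mult)

lemma ideal_sum: "operator_ideal J \<Longrightarrow> (\<And>k. k \<in> A \<Longrightarrow> entry (f k) \<in> J) \<Longrightarrow> entry (\<Sum>k\<in>A. f k) \<in> J"
  by (induction A rule: infinite_finite_induct) (simp_all add: ideal_zero ideal_add)

text \<open>Each complex coefficient is absorbed into the left factor, which stays in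
  \<open>J\<close>.\<close>

lemma ideal_sq_iff:
  assumes J: "operator_ideal J"
  shows "S \<in> ideal_sq J \<longleftrightarrow>
    (\<exists>n x y. (\<forall>k<n. entry (x k) \<in> J \<and> entry (y k) \<in> J) \<and> S = entry (\<Sum>k<(n::nat). x k * y k))"
    (is "_ \<longleftrightarrow> ?R")
proof
  assume "S \<in> ideal_sq J"
  then obtain n c X Y where XY: "\<And>k. k < n \<Longrightarrow> X k \<in> J \<and> Y k \<in> J"
    and S: "S = (\<lambda>i j. \<Sum>k<(n::nat). c k * mat_mult (X k) (Y k) i j)"
    unfolding ideal_sq_def by blast
  \<comment> \<open>For \<open>k\<close> beyond \<open>n\<close> the matrix may be unbounded and the
    value of \<open>Abs_bmat\<close> unspecified; only indices below \<open>n\<close> are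
    consulted.\<close>
  define x where "x k = Abs_bmat (\<lambda>i j. c k * X k i j)" for k
  define y where "y k = Abs_bmat (Y k)" for k
  have x: "entry (x k) = (\<lambda>i j. c k * X k i j)" "entry (x k) \<in> J"
    and y: "entry (y k) = Y k" if "k < n" for k
  proof -
    have "(\<lambda>i j. c k * X k i j) \<in> J" using J XY[OF that] by (simp add: operator_ideal_def)
    then show "entry (x k) = (\<lambda>i j. c k * X k i j)" "entry (x k) \<in> J"
      using J Abs_bmat_inverse unfolding x_def operator_ideal_def by auto
    show "entry (y k) = Y k"
      using J XY[OF that] Abs_bmat_inverse unfolding y_def operator_ideal_def by auto
  qed
  have "entry (x k * y k) i j = c k * mat_mult (X k) (Y k) i j" if k: "k < n" for k i j
  proof -
    obtain x' where x': "X k = entry x'" using ideal_obtain_entry[OF J] XY[OF k] by blast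
    have "(\<lambda>l. c k * (X k i l * Y k l j)) sums (c k * mat_mult (X k) (Y k) i j)"
      unfolding x' y[OF k, symmetric] entry_mult[symmetric] by (rule sums_mult[OF entry_mult_sums])
    moreover have "(\<lambda>l. c k * (X k i l * Y k l j)) sums entry (x k * y k) i j"
      using entry_mult_sums[of "x k" i "y k" j] by (simp add: x y k mult.assoc)
    ultimately show ?thesis by (rule sums_unique2[rotated])
  qed
  then have "S = entry (\<Sum>k<n. x k * y k)"
    unfolding S by (intro ext) (simp add: entry_sum)
  then show ?R using x y XY by metis
next
  assume ?R
  then obtain n x y where xy: "\<forall>k<n. entry (x k) \<in> J \<and> entry (y k) \<in> J"
    and S: "S = entry (\<Sum>k<(n::nat). x k * y k)" by blast
  show "S \<in> ideal_sq J"
    unfolding ideal_sq_def mem_Collect_eq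
    by (intro exI[of _ n] exI[of _ "\<lambda>_. 1"] exI[of _ "\<lambda>k. entry (x k)"] exI[of _ "\<lambda>k. entry (y k)"])
      (use xy in \<open>auto simp: S entry_sum entry_mult intro!: ext\<close>)
qed

lemma ideal_sq_subset:
  assumes J: "operator_ideal J" shows "ideal_sq J \<subseteq> J"
proof
  fix S assume "S \<in> ideal_sq J"
  then obtain n x y where xy: "\<forall>k<n. entry (x k) \<in> J \<and> entry (y k) \<in> J"
    and S: "S = entry (\<Sum>k<(n::nat). x k * y k)" unfolding ideal_sq_iff[OF J] by blast
  show "S \<in> J"
    unfolding S by (rule ideal_sum[OF J]) (use xy in \<open>simp add: ideal_mult_left[OF J]\<close>)
qed

lemma ideal_sq_mult:
  assumes "operator_ideal J" "entry x \<in> J" "entry y \<in> J" shows "entry (x * y) \<in> ideal_sq J"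
  unfolding ideal_sq_iff[OF assms(1)]
  by (intro exI[of _ "Suc 0"] exI[of _ "\<lambda>_. x"] exI[of _ "\<lambda>_. y"]) (use assms in simp)

lemma ideal_sq_zero: "operator_ideal J \<Longrightarrow> entry 0 \<in> ideal_sq J"
  unfolding ideal_sq_iff by (intro exI[of _ 0]) simp

lemma ideal_sq_add:
  assumes J: "operator_ideal J" and "entry a \<in> ideal_sq J" "entry b \<in> ideal_sq J"
  shows "entry (a + b) \<in> ideal_sq J"
proof -
  obtain n x y where 1: "\<And>k. k < n \<Longrightarrow> entry (x k) \<in> J \<and> entry (y k) \<in> J" "a = (\<Sum>k<(n::nat). x k * y k)"
    using assms(2) unfolding ideal_sq_iff[OF J] entry_inject by blast
  obtain m x' y' where 2: "\<And>k. k < m \<Longrightarrow> entry (x' k) \<in> J \<and> entry (y' k) \<in> J" "b = (\<Sum>k<(m::nat). x' k * y' k)"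
    using assms(3) unfolding ideal_sq_iff[OF J] entry_inject by blast
  define X where "X k = (if k < n then x k else x' (k - n))" for k
  define Y where "Y k = (if k < n then y k else y' (k - n))" for k
  have "(\<Sum>k<n + l. X k * Y k) = a + (\<Sum>k<l. x' k * y' k)" for l
    by (induction l) (simp_all add: X_def Y_def 1(2) add.assoc)
  then have "a + b = (\<Sum>k<n + m. X k * Y k)" by (simp add: 2(2))
  moreover have "entry (X k) \<in> J \<and> entry (Y k) \<in> J" if "k < n + m" for k
    using that 1(1)[of k] 2(1)[of "k - n"] by (auto simp: X_def Y_def)
  ultimately show ?thesis
    unfolding ideal_sq_iff[OF J] entry_inject by (intro exI[of _ "n + m"] exI[of _ X] exI[of _ Y]) auto
qed

lemma ideal_sq_mult_left:
  assumes J: "operator_ideal J" and "entry x \<in> ideal_sq J" shows "entry (a * x) \<in> ideal_sq J"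
proof -
  obtain n y z where yz: "\<And>k. k < n \<Longrightarrow> entry (y k) \<in> J \<and> entry (z k) \<in> J" and x: "x = (\<Sum>k<(n::nat). y k * z k)"
    using assms(2) unfolding ideal_sq_iff[OF J] entry_inject by blast
  have "a * x = (\<Sum>k<n. (a * y k) * z k)" by (simp add: x sum_distrib_left mult.assoc)
  then show ?thesis
    unfolding ideal_sq_iff[OF J] entry_inject
    by (intro exI[of _ n] exI[of _ "\<lambda>k. a * y k"] exI[of _ z]) (use yz ideal_mult_left[OF J] in auto)
qed

lemma ideal_sq_sum:
  "operator_ideal J \<Longrightarrow> (\<And>k. k \<in> A \<Longrightarrow> entry (f k) \<in> ideal_sq J) \<Longrightarrow> entry (\<Sum>k\<in>A. f k) \<in> ideal_sq J"
  by (induction A rule: infinite_finite_induct) (simp_all add: ideal_sq_zero ideal_sq_add)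

section \<open>Isometries permuting the basis\<close>

text \<open>Each column has a single 1, so the form collapses to a sum over the set \<open>T\<close>
  of columns whose 1 lies in the truncation. After Cauchy-Schwarz, injectivity keeps any |y i|^2
  from being counted twice.\<close>

lemma form_bound_inj:
  assumes "inj f" shows "form_bound (\<lambda>i j. if i = f j then 1 else 0) 1"
  unfolding form_bound_def
proof (intro conjI allI)
  fix x y :: "nat \<Rightarrow> complex" and m n
  define T where "T = {j. j < n \<and> f j < m}"
  have fT: "finite T" by (rule finite_subset[of _ "{..<n}"]) (auto simp: T_def)
  have "(\<Sum>i<m. \<Sum>j<n. y i * (if i = f j then 1 else 0) * x j) = (\<Sum>j<n. \<Sum>i<m. if i = f j then y i * x j else 0)"
    by (subst sum.swap) (intro sum.cong refl, simp)
  also have "\<dots> = (\<Sum>j<n. if f j < m then y (f j) * x j else 0)"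
    by (simp add: sum.delta)
  also have "\<dots> = (\<Sum>j\<in>T. y (f j) * x j)"
    unfolding T_def by (rule sum.mono_neutral_cong_right) auto
  also have "cmod \<dots> \<le> (\<Sum>j\<in>T. cmod (y (f j)) * cmod (x j))"
    by (rule order_trans[OF norm_sum]) (simp add: norm_mult)
  also have "\<dots> \<le> L2_set (\<lambda>j. cmod (y (f j))) T * L2_set (\<lambda>j. cmod (x j)) T"
    using L2_set_mult_ineq[of "\<lambda>j. cmod (y (f j))" "\<lambda>j. cmod (x j)" T] by simp
  also have "\<dots> \<le> l2norm y m * l2norm x n"
  proof (intro mult_mono)
    have "(\<Sum>j\<in>T. (cmod (y (f j)))\<^sup>2) = (\<Sum>i\<in>f ` T. (cmod (y i))\<^sup>2)"
      by (subst sum.reindex) (use assms in \<open>auto simp: inj_def inj_on_def\<close>)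
    also have "\<dots> \<le> (\<Sum>i<m. (cmod (y i))\<^sup>2)"
      by (intro sum_mono2) (auto simp: T_def)
    finally show "L2_set (\<lambda>j. cmod (y (f j))) T \<le> l2norm y m"
      unfolding l2norm_def L2_set_def by (rule real_sqrt_le_mono)
    show "L2_set (\<lambda>j. cmod (x j)) T \<le> l2norm x n"
      unfolding l2norm_def L2_set_def by (intro real_sqrt_le_mono sum_mono2) (auto simp: T_def)
  qed (auto intro: L2_set_nonneg)
  finally show "cmod (\<Sum>i<m. \<Sum>j<n. y i * (if i = f j then 1 else 0) * x j) \<le> 1 * (l2norm y m * l2norm x n)"
    by simp
qed simp

text \<open>For injective \<open>f\<close>, the isometry sending the j-th basis vector to the one
  with index \<open>f j\<close>; otherwise the matrix may be unbounded and the value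
  unspecified.\<close>

definition basis_map :: "(nat \<Rightarrow> nat) \<Rightarrow> bmat" where
  "basis_map f = Abs_bmat (\<lambda>i j. if i = f j then 1 else 0)"

lemma entry_basis_map: "inj f \<Longrightarrow> entry (basis_map f) i j = (if i = f j then 1 else 0)"
  unfolding basis_map_def using form_bound_inj[of f] bounded_mat_iff by (subst Abs_bmat_inverse) auto

lemma entry_mult_basis_map:
  assumes "inj f" shows "entry (x * basis_map f) i j = entry x i (f j)"
proof -
  have "(\<lambda>k. if k = f j then entry x i k else 0) sums entry x i (f j)" by (rule sums_single)
  moreover have "(\<lambda>k. entry x i k * entry (basis_map f) k j) = (\<lambda>k. if k = f j then entry x i k else 0)"
    using assms by (auto simp: entry_basis_map)
  ultimately show ?thesis using entry_mult_sums[of x i "basis_map f" j] sums_unique2 by simp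
qed

lemma entry_star_basis_map_mult:
  assumes "inj f" shows "entry (star (basis_map f) * x) i j = entry x (f i) j"
proof -
  have "entry (star (star x * basis_map f)) i j = entry x (f i) j"
    by (simp add: entry_star adj_def entry_mult_basis_map[OF assms])
  then show ?thesis by (simp add: star_mult)
qed

lemma star_basis_map_mult_self: "inj f \<Longrightarrow> star (basis_map f) * basis_map f = 1"
  by (rule bmat_eqI) (auto simp: entry_star_basis_map_mult entry_basis_map entry_one inj_eq)

lemma star_basis_map_mult_disjoint:
  "inj f \<Longrightarrow> inj g \<Longrightarrow> (\<And>i j. f i \<noteq> g j) \<Longrightarrow> star (basis_map f) * basis_map g = 0"
  by (rule bmat_eqI) (simp add: entry_star_basis_map_mult entry_basis_map entry_zero)

section \<open>Spans of diagonal orbits\<close>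

lemma diag_orbit_corner:
  assumes J: "operator_ideal J" and A: "A \<in> diag_orbit_sa J"
    and fg: "inj f" "inj g" "\<And>i j. f i \<noteq> g j"
  shows "\<exists>a. A = entry a \<and> entry (star (basis_map f) * a * basis_map g) \<in> ideal_sq J"
proof -
  obtain V D where A: "A = mat_mult (mat_mult V D) (adj V)" and D: "diagonal D" "D \<in> J"
    and V: "V \<in> unitary_J J"
    using A unfolding diag_orbit_sa_def by blast
  obtain d where d: "D = entry d" using ideal_obtain_entry[OF J D(2)] .
  have "bounded_mat V" using V by (simp add: unitary_J_def unitary_def)
  then obtain v where v: "V = entry v" using Abs_bmat_inverse[of V] by (metis mem_Collect_eq)
  have "entry (v * star v) = entry 1"
    using V by (simp add: unitary_J_def unitary_def entry_mult entry_star v one_bmat.rep_eq)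
  then have vv: "v * star v = 1" by (simp add: entry_inject)
  define k where "k = v - 1"
  have k: "entry k \<in> J"
    using V by (simp add: unitary_J_def k_def entry_diff[abs_def] v one_bmat.rep_eq)
  define a where "a = v * d * star v"
  \<comment> \<open>The sign is attached to \<open>d\<close>, so that the bracket is a sum of two
    products of elements of \<open>J\<close>.\<close>
  have a_eq: "a = d + (k * d + (- d) * k) * star v"
  proof -
    have "(k * d + (- d) * k) * star v = v * d * star v - d * (v * star v)"
      by (simp add: k_def algebra_simps)
    then show ?thesis by (simp add: vv a_def)
  qed
  \<comment> \<open>Regrouped so that both factors of each product absorb their outer operators and
    stay in \<open>J\<close>; closure of \<open>ideal_sq J\<close> under addition then
    suffices.\<close>
  have "star (basis_map f) * a * basis_map g = star (basis_map f) * d * basis_map g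
      + ((star (basis_map f) * k) * (d * star v * basis_map g)
       + (star (basis_map f) * (- d)) * (k * star v * basis_map g))"
    unfolding a_eq by (simp add: algebra_simps)
  \<comment> \<open>The entries of this corner are the \<open>(f i, g j)\<close> entries of
    \<open>d\<close>, all off the diagonal because the ranges are disjoint.\<close>
  also have "star (basis_map f) * d * basis_map g = 0"
    using D(1) fg by (intro bmat_eqI)
      (simp add: entry_mult_basis_map entry_star_basis_map_mult entry_zero diagonal_def d)
  finally have "star (basis_map f) * a * basis_map g = (star (basis_map f) * k) * (d * star v * basis_map g)
       + (star (basis_map f) * (- d)) * (k * star v * basis_map g)" by simp
  moreover have "entry (- d) \<in> J"
    using ideal_mult_left[OF J, of d "-1"] D(2) by (simp add: d)
  ultimately have "entry (star (basis_map f) * a * basis_map g) \<in> ideal_sq J"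
    using k D(2) unfolding d
    by (simp add: ideal_sq_add[OF J] ideal_sq_mult[OF J] ideal_mult_left[OF J] ideal_mult_right[OF J]
        del: mult_minus_right mult_minus_left)
  moreover have "A = entry a" by (simp add: A a_def entry_mult entry_star v d)
  ultimately show ?thesis by blast
qed

text \<open>A self-adjoint \<open>h\<close> is placed off the diagonal: the compression of \<open>w\<^sub>0 h w\<^sub>1\<^sup>* + w\<^sub>1 h w\<^sub>0\<^sup>*\<close> to its
  \<open>(0,1)\<close> corner is \<open>h\<close>, while that corner kills diagonal matrices.\<close>
lemma self_adjoint_in_ideal_sq:
  assumes J: "operator_ideal J" and span: "self_adjoint_part J \<subseteq> real_span_mat (diag_orbit_sa J)"
    and h: "star h = h" "entry h \<in> J"
  shows "entry h \<in> ideal_sq J"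
proof -
  \<comment> \<open>Even and odd indices: here infinite dimension enters, H being split into two
    copies of itself.\<close>
  define f g :: "nat \<Rightarrow> nat" where "f i = 2 * i" and "g i = 2 * i + 1" for i
  have fg: "inj f" "inj g" "f i \<noteq> g j" "g i \<noteq> f j" for i j
    unfolding f_def g_def inj_def by (simp_all, presburger+)
  define w0 w1 where "w0 = basis_map f" and "w1 = basis_map g"
  have w: "star w0 * w0 = 1" "star w1 * w1 = 1" "star w0 * w1 = 0"
    unfolding w0_def w1_def
    by (simp_all add: fg star_basis_map_mult_self star_basis_map_mult_disjoint)
  define x where "x = w0 * h * star w1 + w1 * h * star w0"
  have "star x = x" by (simp add: x_def star_add star_mult h(1) mult.assoc)
  moreover have "entry x \<in> J"
    unfolding x_def by (intro ideal_add[OF J] ideal_mult_left[OF J] ideal_mult_right[OF J] h(2))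
  ultimately have "entry x \<in> self_adjoint_part J"
    by (simp add: self_adjoint_part_def entry_star[symmetric])
  then obtain n r A where A: "\<And>k. k < n \<Longrightarrow> A k \<in> diag_orbit_sa J"
    and xA: "entry x = (\<lambda>i j. \<Sum>k<(n::nat). complex_of_real (r k) * A k i j)"
    using span unfolding real_span_mat_def by blast
  have "\<forall>k. \<exists>a. k < n \<longrightarrow> A k = entry a \<and> entry (star w0 * a * w1) \<in> ideal_sq J"
    unfolding w0_def w1_def using diag_orbit_corner[OF J A fg(1,2,3)] by blast
  from choice[OF this] obtain a where a: "\<And>k. k < n \<Longrightarrow> A k = entry (a k)"
    "\<And>k. k < n \<Longrightarrow> entry (star w0 * a k * w1) \<in> ideal_sq J" by blast
  have x_sum: "x = (\<Sum>k<n. r k *\<^sub>R a k)"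
    by (rule bmat_eqI) (simp add: xA entry_sum entry_scaleR a(1))
  \<comment> \<open>The second summand of \<open>x\<close> leaves \<open>star w0 * w1\<close> on
    both sides of \<open>h\<close>, which is 0.\<close>
  have "star w0 * x * w1 = (star w0 * w0) * h * (star w1 * w1) + (star w0 * w1) * h * (star w0 * w1)"
    by (simp only: x_def distrib_left distrib_right mult.assoc)
  then have "h = star w0 * x * w1" by (simp add: w)
  \<comment> \<open>Real coefficients are written as left factors \<open>r k *\<^sub>R 1\<close>, so
    that \<open>ideal_sq_mult_left\<close> covers them.\<close>
  also have "\<dots> = (\<Sum>k<n. (r k *\<^sub>R 1) * (star w0 * a k * w1))"
    by (simp add: x_sum sum_distrib_left sum_distrib_right)
  finally have h_sum: "h = (\<Sum>k<n. (r k *\<^sub>R 1) * (star w0 * a k * w1))" .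
  show ?thesis
    by (subst h_sum, rule ideal_sq_sum[OF J], rule ideal_sq_mult_left[OF J], rule a(2)) simp
qed

theorem theorem4p3:
  assumes "operator_ideal J"
    and "ideal_sq J \<noteq> J"
  shows "real_span_mat (diag_orbit_sa J) \<noteq> self_adjoint_part J"
proof
  assume span: "real_span_mat (diag_orbit_sa J) = self_adjoint_part J"
  have "J \<subseteq> ideal_sq J"
  proof
    fix Y assume "Y \<in> J"
    then obtain y where y: "Y = entry y" "entry y \<in> J"
      using ideal_obtain_entry[OF assms(1)] by metis
    obtain h u v where h: "star h = h" "y = u * h" "h = v * y"
      using self_adjoint_factor .
    have "entry h \<in> J" unfolding h(3) by (rule ideal_mult_left[OF assms(1) y(2)])
    then have "entry h \<in> ideal_sq J"
      using self_adjoint_in_ideal_sq[OF assms(1) _ h(1)] span by blast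
    then show "Y \<in> ideal_sq J"
      unfolding y(1) by (subst h(2)) (rule ideal_sq_mult_left[OF assms(1)])
  qed
  then show False using ideal_sq_subset[OF assms(1)] assms(2) by blast
qed

end
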